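(* Consider the two-tubes IPM equations (defined in the context) with parameter $l>0$. There exists $l_0>0$ such that for every $l\in(0,l_0)$ there exists a propagating terrace consisting of two traveling waves, with speeds $v_1^*(l)\le v_2^*(l)$, connecting the states $$\sigma_0=(-1,-1,0,0,0),\qquad \sigma_1=(c_1^*(l),c_2^*(l),u_1^*(l),u_2^*(l),0),\qquad \sigma_2=(1,1,0,0,0)$$ (that is, a traveling wave of speed $v_1^*(l)$ connecting $\sigma_0$ to $\sigma_1$ and a traveling wave of speed $v_2^*(l)$ connecting $\sigma_1$ to $\sigma_2$), for some real numbers $c_1^*(l),c_2^*(l),u_1^*(l),u_2^*(l)$ with $\sigma_1$ a stationary solution. Moreover, $$\lim_{l\to0}c_1^*(l)=-\lim_{l\to0}c_2^*(l)=\tfrac12,\qquad \lim_{l\to0}v_2^*(l)=-\lim_{l\to0}v_1^*(l)=\tfrac14 .$$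
   Context: Two-tubes IPM equations with parameter $l>0$: unknowns $c_1,c_2,u_1,u_2,q$, real functions of $(t,y)\in[0,\infty)\times\mathbb{R}$, satisfying $$\partial_t c_1+\partial_y(u_1c_1)-\partial_{yy}c_1=-f,\qquad \partial_t c_2+\partial_y(u_2c_2)-\partial_{yy}c_2=f,$$ $$\partial_y q=u_1-u_2+c_1-c_2,\qquad \partial_y u_1=\frac{q}{l^2},\qquad u_1+u_2=0,$$ where, with $u_T:=-q/l$, $f=\frac{u_T}{l}c_1$ if $u_T\ge0$ and $f=\frac{u_T}{l}c_2$ if $u_T\le 0$. A traveling wave with speed $v\in\mathbb{R}$ connecting states $g_-,g_+\in\mathbb{R}^5$ is a solution of the form $(c_1,c_2,u_1,u_2,q)(t,y)=\tilde g(y-vt)$ with $\tilde g:\mathbb{R}\to\mathbb{R}^5$ continuous (and smooth enough to solve the equations classically), $\tilde g(-\infty)=g_-$, $\tilde g(+\infty)=g_+$. A propagating terrace connecting $\alpha\in\mathbb{R}^5$ to $\beta\in\mathbb{R}^5$ is a pair of finite sequences $(\sigma_k)_{0\le k\le N}$, $(g_k)_{1\le k\le N}$ such that each $\sigma_k\in\mathbb{R}^5$ is a stationary (constant) solution of the equations, $\sigma_0=\alpha$, $\sigma_N=\beta$, each $g_k$ is a traveling wave connecting $\sigma_{k-1}$ to $\sigma_k$ with speed $v_k$, and $v_1\le v_2\le\dots\le v_N$. *)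

theory Defs
  imports "HOL-Analysis.Analysis"
begin

text \<open>States (c1, c2, u1, u2, q) in R^5, represented as 5-tuples.\<close>
type_synonym state = "real \<times> real \<times> real \<times> real \<times> real"

definition exch :: "real \<Rightarrow> real \<Rightarrow> real \<Rightarrow> real \<Rightarrow> real" where
  "exch l c1 c2 q = (let uT = - q / l in if uT \<ge> 0 then uT / l * c1 else uT / l * c2)"

definition dt_eq :: "(real \<Rightarrow> real \<Rightarrow> real) \<Rightarrow> real \<Rightarrow> real \<Rightarrow> real \<Rightarrow> bool" where
  "dt_eq w t y a \<longleftrightarrow> ((\<lambda>s. w s y) has_real_derivative a) (at t within {0..})"

definition dy_eq :: "(real \<Rightarrow> real \<Rightarrow> real) \<Rightarrow> real \<Rightarrow> real \<Rightarrow> real \<Rightarrow> bool" where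
  "dy_eq w t y a \<longleftrightarrow> ((\<lambda>z. w t z) has_real_derivative a) (at y)"

definition dyy_eq :: "(real \<Rightarrow> real \<Rightarrow> real) \<Rightarrow> real \<Rightarrow> real \<Rightarrow> real \<Rightarrow> bool" where
  "dyy_eq w t y a \<longleftrightarrow> (\<forall>z. (\<lambda>x. w t x) differentiable (at z))
      \<and> (deriv (\<lambda>x. w t x) has_real_derivative a) (at y)"

definition ipm_solution :: "real \<Rightarrow> (real \<Rightarrow> real \<Rightarrow> state) \<Rightarrow> bool" where
  "ipm_solution l S \<longleftrightarrow>
    (let c1 = (\<lambda>t y. fst (S t y));
         c2 = (\<lambda>t y. fst (snd (S t y)));
         u1 = (\<lambda>t y. fst (snd (snd (S t y))));
         u2 = (\<lambda>t y. fst (snd (snd (snd (S t y)))));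
         q  = (\<lambda>t y. snd (snd (snd (snd (S t y)))))
     in \<forall>t\<ge>0. \<forall>y.
       (\<exists>a b e. dt_eq c1 t y a \<and> dy_eq (\<lambda>t y. u1 t y * c1 t y) t y b \<and> dyy_eq c1 t y e
            \<and> a + b - e = - exch l (c1 t y) (c2 t y) (q t y))
     \<and> (\<exists>a b e. dt_eq c2 t y a \<and> dy_eq (\<lambda>t y. u2 t y * c2 t y) t y b \<and> dyy_eq c2 t y e
            \<and> a + b - e = exch l (c1 t y) (c2 t y) (q t y))
     \<and> dy_eq q t y (u1 t y - u2 t y + c1 t y - c2 t y)
     \<and> dy_eq u1 t y (q t y / l\<^sup>2)
     \<and> u1 t y + u2 t y = 0)"

definition stationary :: "real \<Rightarrow> state \<Rightarrow> bool" where
  "stationary l \<sigma> \<longleftrightarrow> ipm_solution l (\<lambda>t y. \<sigma>)"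

definition traveling_wave :: "real \<Rightarrow> (real \<Rightarrow> state) \<Rightarrow> real \<Rightarrow> state \<Rightarrow> state \<Rightarrow> bool" where
  "traveling_wave l g v gm gp \<longleftrightarrow>
     continuous_on UNIV g \<and> (g \<longlongrightarrow> gm) at_bot \<and> (g \<longlongrightarrow> gp) at_top
     \<and> ipm_solution l (\<lambda>t y. g (y - v * t))"

definition propagating_terrace ::
  "real \<Rightarrow> state \<Rightarrow> state \<Rightarrow> state list \<Rightarrow> (real \<Rightarrow> state) list \<Rightarrow> real list \<Rightarrow> bool" where
  "propagating_terrace l \<alpha> \<beta> sig gs vs \<longleftrightarrow>
     length sig = length gs + 1 \<and> length vs = length gs
     \<and> (\<forall>k < length sig. stationary l (sig ! k))
     \<and> sig ! 0 = \<alpha> \<and> sig ! length gs = \<beta>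
     \<and> (\<forall>k < length gs. traveling_wave l (gs ! k) (vs ! k) (sig ! k) (sig ! Suc k))
     \<and> sorted vs"

end

theory Submission
  imports Defs "HOL-Real_Asymp.Real_Asymp"
begin

text \<open>
  Consider the first wave, and use $z = (c_1 + 1)/\mu \in (0,1)$ as coordinate, where $\mu$ is the
  jump of $c_1$. In the limit $l = 0$ one finds $c_2' = c_1'/3$ and $u_z = -\mu/3$, and $z$ is a
  logistic profile. For $l > 0$ let $r = c_2'/c_1'$ and $g = -u_z/\mu$, and let $P = P(z)$ be the
  rescaled $c_1'$, so that $P'' = -g$ with $P(0) = P(1) = 0$. The equation $l^2 u'' = 2u + c_1 - c_2$
  factors into two first-order equations, linked by an auxiliary function $k$, with a layer width
  $\beta$ of order $l$. Then $r$, $k$ and $g$ are the bounded solutions of scalar equations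
  $y' = \pm A (y - f)$ with $A > 0$; such a solution is a weighted average of $f$, whatever $A$ is.
  For constant $f$ the weights do not matter, so near $g = k = 1/3$ the Lipschitz constant of
  $(g, k) \mapsto r \mapsto k \mapsto g$ is, up to $O(l)$, the factor $1/2$ of the source term
  $(1 - r)/2$ in the equation for $k$. The fixed point gives the first wave within $O(l)$ of the
  explicit one. Normalising $z$ to $(0,1)$ leaves the scale $\mu$ free, and
  $\mu = 1/(1 - \int_0^1 g\,dz)$ makes the intermediate state antisymmetric, $c_2 = -c_1$; it is
  therefore invariant under the reflection $(c_1, c_2, u, q)(y) \mapsto (-c_2, -c_1, u, -q)(-y)$,
  $v \mapsto -v$, which turns the first wave into the second.
\<close>

subsection \<open>Bounded solutions of scalar linear equations\<close>

definition logistic :: "real \<Rightarrow> real" where "logistic x = 1 / (1 + exp (- x))"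

lemma logistic_pos: "0 < logistic x" and logistic_less_1: "logistic x < 1"
  by (simp_all add: logistic_def add_pos_pos)

lemma logistic_minus: "logistic (- x) = 1 - logistic x"
proof -
  have "1 + exp x > 0" "1 + exp (-x) > 0" "exp x * exp (-x) = 1"
    by (simp_all add: add_pos_pos exp_minus)
  then show ?thesis unfolding logistic_def by (simp add: field_simps)
qed

lemma logistic_deriv [derivative_intros]:
  assumes "(f has_real_derivative D) (at x)"
  shows "((\<lambda>x. logistic (f x)) has_real_derivative logistic (f x) * (1 - logistic (f x)) * D) (at x)"
proof -
  have p: "1 + exp (- f x) > 0" by (simp add: add_pos_pos)
  have "((\<lambda>x. 1 / (1 + exp (- f x))) has_real_derivative
      (exp (- f x) * D) / (1 + exp (- f x))^2) (at x)"
    using p by (auto intro!: derivative_eq_intros assms simp: power2_eq_square)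
  moreover have "(exp (- f x) * D) / (1 + exp (- f x))^2 = logistic (f x) * (1 - logistic (f x)) * D"
    using p unfolding logistic_def by (simp add: field_simps power2_eq_square)
  ultimately show ?thesis unfolding logistic_def by simp
qed

lemma logistic_cont [continuous_intros]:
  "continuous_on A f \<Longrightarrow> continuous_on A (\<lambda>x. logistic (f x))"
  unfolding logistic_def by (intro continuous_intros) (auto simp: add_pos_pos add_nonneg_eq_0_iff)

lemma logistic_at_top: "(logistic \<longlongrightarrow> 1) at_top" and logistic_at_bot:
    "(logistic \<longlongrightarrow> 0) at_bot"
  unfolding logistic_def by real_asymp+

lemma antiderivative_UNIV:
  fixes f :: "real \<Rightarrow> real"
  assumes "continuous_on UNIV f"
  obtains F where "\<And>x. (F has_real_derivative f x) (at x)"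
proof -
  have "\<exists>F. \<forall>x::real. -\<infinity> < ereal x \<longrightarrow> ereal x < \<infinity>
      \<longrightarrow> (F has_vector_derivative f x) (at x)"
    by (rule einterval_antiderivative)
      (use assms in \<open>auto simp: continuous_on_eq_continuous_at\<close>)
  then show ?thesis
    using that by (auto simp: has_real_derivative_iff_has_vector_derivative)
qed

text \<open>
  A lower bound
      by a multiple of \<open>logistic\<close> makes the integral of \<open>a / c\<close> diverge at
      $+\infty$,
  which is all that uniqueness of the bounded solution needs; \<open>a / c\<close> may vanish at $-\infty$.
\<close>

definition dominates ::
    "(real \<Rightarrow> real) \<Rightarrow> (real \<Rightarrow> real) \<Rightarrow> bool" where
  "dominates a c \<longleftrightarrow> continuous_on UNIV a \<and> continuous_on UNIV c \<and>
     (\<forall>x. 0 < a x \<and> 0 < c x) \<and> (\<exists>e>0. \<forall>x. e * logistic x \<le> a x / c x)"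

text \<open>Solutions of \<open>c y' = a y - b\<close> with positive \<open>a\<close>,
  \<open>c\<close> drift apart to the right, so boundedness takes the place of an initial value.
  Under \<open>dominates a c\<close> the bounded solution at \<open>x\<close> is a weighted average
  of \<open>b / a\<close> over the points to the right of \<open>x\<close>.\<close>

definition bsol_up ::
    "(real \<Rightarrow> real) \<Rightarrow> (real \<Rightarrow> real) \<Rightarrow> (real \<Rightarrow>
    real) \<Rightarrow> (real \<Rightarrow> real) \<Rightarrow> bool" where
  "bsol_up a b c y \<longleftrightarrow> bounded (range y) \<and>
     (\<forall>x. (y has_real_derivative (a x * y x - b x) / c x) (at x))"

text \<open>A maximum principle. With \<open>I\<close> an antiderivative of \<open>a / c\<close>,
  the function \<open>(y - M) * exp (- I)\<close> is nondecreasing, so an excess of \<open>y\<close>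
  over \<open>M\<close> at one point grows at least like \<open>exp I\<close>. Domination makes
  \<open>I\<close> unbounded, against the boundedness of \<open>y\<close>.\<close>

lemma bsol_up_le:
  assumes ac: "dominates a c" and y: "bsol_up a b c y" and b: "\<And>x. b x \<le> M * a x"
  shows "y x0 \<le> M"
proof (rule ccontr)
  assume gt: "\<not> y x0 \<le> M"
  obtain e where e: "e > 0" "\<And>x. e * logistic x \<le> a x / c x"
    using ac by (auto simp: dominates_def)
  have pos: "\<And>x. 0 < a x" "\<And>x. 0 < c x" using ac by (auto simp: dominates_def)
  have "continuous_on UNIV (\<lambda>x. a x / c x)"
    using ac by (intro continuous_intros) (auto simp: dominates_def less_le)
  then obtain I where I: "\<And>x. (I has_real_derivative a x / c x) (at x)"
    using antiderivative_UNIV by blast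
  have dy: "\<And>x. (y has_real_derivative (a x * y x - b x) / c x) (at x)"
    using y by (auto simp: bsol_up_def)
  have mono1: "(y x0 - M) * exp (- I x0) \<le> (y x - M) * exp (- I x)" if "x0 \<le> x" for x
  proof (rule DERIV_nonneg_imp_nondecreasing[OF that])
    fix x
    have "((\<lambda>x. (y x - M) * exp (- I x)) has_real_derivative
       exp (- I x) * (M * a x - b x) / c x) (at x)"
      by (rule derivative_eq_intros dy I refl)+ (use pos(2)[of x] in \<open>simp add: field_simps\<close>)
    moreover have "0 \<le> exp (- I x) * (M * a x - b x) / c x"
      using b[of x] pos(2)[of x] by (intro divide_nonneg_pos mult_nonneg_nonneg) auto
    ultimately show "\<exists>z. ((\<lambda>x. (y x - M) * exp (- I x)) has_real_derivative z) (at x)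
        \<and> 0 \<le> z"
      by blast
  qed
  \<comment> \<open>\<open>ln (1 + exp x)\<close> is an antiderivative of \<open>logistic\<close>;
    integrating the lower bound in \<open>dominates\<close> shows that \<open>I\<close> grows at
    least linearly with slope \<open>e\<close>.\<close>
  have mono2: "I x0 - e * ln (1 + exp x0) \<le> I x - e * ln (1 + exp x)" if "x0 \<le> x" for x
  proof (rule DERIV_nonneg_imp_nondecreasing[OF that])
    fix x :: real
    have p: "1 + exp x > 0" by (simp add: add_pos_pos)
    have q: "exp x / (1 + exp x) = logistic x"
      unfolding logistic_def by (simp add: exp_minus field_simps)
    have "((\<lambda>x. I x - e * ln (1 + exp x)) has_real_derivative
       a x / c x - e * (exp x / (1 + exp x))) (at x)"
      by (rule derivative_eq_intros I refl p)+ simp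
    then show "\<exists>z. ((\<lambda>x. I x - e * ln (1 + exp x)) has_real_derivative z) (at x)
        \<and> 0 \<le> z"
      using e(2)[of x] q by (intro exI[of _ "a x / c x - e * (exp x / (1 + exp x))"]) auto
  qed
  obtain K where K: "\<And>x. \<bar>y x\<bar> \<le> K"
    using y by (auto simp: bsol_up_def bounded_iff)
  define m where "m = (y x0 - M) * exp (- I x0)"
  have m: "m > 0" using gt by (auto simp: m_def)
  have "filterlim (\<lambda>x. m * exp (I x0 - e * ln (1 + exp x0) + e * x)) at_top at_top"
    using e(1) m by real_asymp
  then have "eventually (\<lambda>x. m * exp (I x0 - e * ln (1 + exp x0) + e * x) > K - M) at_top"
    by (simp add: filterlim_at_top_dense)
  then have "eventually (\<lambda>x. m * exp (I x0 - e * ln (1 + exp x0) + e * x) > K - M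
      \<and> x \<ge> x0) at_top"
    using eventually_ge_at_top eventually_conj by blast
  then obtain x where x: "m * exp (I x0 - e * ln (1 + exp x0) + e * x) > K - M" "x \<ge> x0"
    by (auto simp: eventually_at_top_linorder)
  have "x \<le> ln (1 + exp x)"
    by (subst ln_ge_iff) (auto simp: add_pos_pos)
  then have "e * x \<le> e * ln (1 + exp x)" using e(1) by simp
  with mono2[OF x(2)] have "I x0 - e * ln (1 + exp x0) + e * x \<le> I x" by linarith
  then have "m * exp (I x0 - e * ln (1 + exp x0) + e * x) \<le> m * exp (I x)"
    using m by simp
  also have "\<dots> \<le> ((y x - M) * exp (- I x)) * exp (I x)"
    using mono1[OF x(2)] by (auto simp: m_def intro!: mult_right_mono)
  also have "\<dots> = y x - M" by (simp add: exp_minus)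
  finally show False using x(1) K[of x] by linarith
qed

lemma bsol_up_uminus: "bsol_up a b c y \<Longrightarrow> bsol_up a (\<lambda>x. - b x) c (\<lambda>x. - y x)"
  unfolding bsol_up_def by (auto intro!: derivative_eq_intros simp: bounded_iff field_simps
      minus_divide_left diff_divide_distrib)

lemma bsol_up_ge:
  assumes "dominates a c" "bsol_up a b c y" "\<And>x. M * a x \<le> b x"
  shows "M \<le> y x"
  using bsol_up_le[OF assms(1) bsol_up_uminus[OF assms(2)], of "-M" x] assms(3) by simp

lemma bsol_up_abs_le:
  assumes "dominates a c" "bsol_up a b c y" "\<And>x. \<bar>b x\<bar> \<le> M * a x"
  shows "\<bar>y x\<bar> \<le> M"
proof -
  have "b x \<le> M * a x" "- M * a x \<le> b x" for x using assms(3)[of x] by auto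
  then have "y x \<le> M" "- M \<le> y x"
    by (auto intro!: bsol_up_le[OF assms(1,2)] bsol_up_ge[OF assms(1,2)])
  then show ?thesis by simp
qed

lemma bsol_up_shift:
  assumes "bsol_up a b c y" "\<And>x. (z has_real_derivative z' x) (at x)" "bounded (range z)"
    "\<And>x. c x \<noteq> 0"
  shows "bsol_up a (\<lambda>x. b x - a x * z x + c x * z' x) c (\<lambda>x. y x - z x)"
  unfolding bsol_up_def
proof (intro conjI allI)
  show "bounded (range (\<lambda>x. y x - z x))"
    using assms by (auto simp: bsol_up_def intro: bounded_minus_comp)
  fix x
  have "((\<lambda>x. y x - z x) has_real_derivative (a x * y x - b x) / c x - z' x) (at x)"
    by (rule DERIV_diff) (use assms in \<open>auto simp: bsol_up_def\<close>)
  moreover have "(a x * y x - b x) / c x - z' x =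
      (a x * (y x - z x) - (b x - a x * z x + c x * z' x)) / c x"
    using assms(4)[of x] by (simp add: field_simps)
  ultimately show "((\<lambda>x. y x - z x) has_real_derivative
       (a x * (y x - z x) - (b x - a x * z x + c x * z' x)) / c x) (at x)" by simp
qed

text \<open>Treating \<open>y2\<close> as a shift leaves an equation with coefficients
  \<open>a1\<close>, \<open>c1\<close> for the difference. The change of the leading coefficient
  enters only multiplied by the residual \<open>a2 * y2 - b2\<close>, which is small when
  \<open>y2\<close> is close to \<open>b2 / a2\<close>.\<close>

lemma bsol_up_diff:
  assumes "dominates a1 c1" "bsol_up a1 b1 c1 y1" "bsol_up a2 b2 c2 y2" "\<And>x. c2 x \<noteq> 0"
    and "\<And>x. \<bar>b1 x - b2 x - (a1 x - a2 x) * y2 x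
    + (c1 x / c2 x - 1) * (a2 x * y2 x - b2 x)\<bar> \<le> M * a1 x"
  shows "\<bar>y1 x - y2 x\<bar> \<le> M"
proof (rule bsol_up_abs_le[where y = "\<lambda>x. y1 x - y2 x", OF assms(1)])
  have c1: "c1 x \<noteq> 0" for x using assms(1) by (auto simp: dominates_def less_le)
  show "bsol_up a1 (\<lambda>x. b1 x - a1 x * y2 x + c1 x * ((a2 x * y2 x - b2 x) / c2 x)) c1
      (\<lambda>x. y1 x - y2 x)"
    by (rule bsol_up_shift[where z' = "\<lambda>x. (a2 x * y2 x - b2 x) / c2 x", OF assms(2)])
    (use assms c1 in \<open>auto simp: bsol_up_def\<close>)
  fix x
  have "b1 x - a1 x * y2 x + c1 x * ((a2 x * y2 x - b2 x) / c2 x) =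
    b1 x - b2 x - (a1 x - a2 x) * y2 x + (c1 x / c2 x - 1) * (a2 x * y2 x - b2 x)"
    using assms(4)[of x] by (simp add: field_simps)
  then show "\<bar>b1 x - a1 x * y2 x + c1 x * ((a2 x * y2 x - b2 x) / c2 x)\<bar> \<le> M * a1 x"
    using assms(5)[of x] by simp
qed

text \<open>The solution is \<open>exp I * (w - W)\<close> where \<open>w\<close> plays the role of
  the limit of \<open>W\<close> at infinity. Instead of an improper integral, a monotone squeeze is
  used: \<open>L\<close> increases, \<open>U\<close> decreases and \<open>L \<le> U\<close>, so
  \<open>w\<close> can be any number separating their ranges, and the gap between them gives
  \<open>\<bar>y\<bar> \<le> M\<close> at once.\<close>

lemma bsol_up_exists:
  assumes ac: "dominates a c" and bc: "continuous_on UNIV b" and b: "\<And>x. \<bar>b x\<bar> \<le> M * a x"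
  shows "\<exists>y. bsol_up a b c y"
proof -
  have pos: "\<And>x. 0 < a x" "\<And>x. 0 < c x" using ac by (auto simp: dominates_def)
  have "continuous_on UNIV (\<lambda>x. a x / c x)"
    using ac by (intro continuous_intros) (auto simp: dominates_def less_le)
  then obtain I where I: "\<And>x. (I has_real_derivative a x / c x) (at x)"
    using antiderivative_UNIV by blast
  have cI: "continuous_on UNIV I"
    using I by (meson DERIV_isCont continuous_at_imp_continuous_on)
  have "continuous_on UNIV (\<lambda>x. exp (- I x) * b x / c x)"
    using ac bc cI by (intro continuous_intros) (auto simp: dominates_def less_le)
  then obtain W where W: "\<And>x. (W has_real_derivative exp (- I x) * b x / c x) (at x)"
    using antiderivative_UNIV by blast
  define L where "L = (\<lambda>x. W x - M * exp (- I x))"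
  define U where "U = (\<lambda>x. W x + M * exp (- I x))"
  have Lm: "L x \<le> L x'" if "x \<le> x'" for x x'
  proof (rule DERIV_nonneg_imp_nondecreasing[OF that])
    fix x
    have "(L has_real_derivative exp (- I x) * (b x + M * a x) / c x) (at x)"
      unfolding L_def by (rule derivative_eq_intros W I refl)+ (use pos(2)[of x]
      in \<open>simp add: field_simps\<close>)
    moreover have "0 \<le> exp (- I x) * (b x + M * a x) / c x"
      using b[of x] pos(2)[of x] by (intro divide_nonneg_pos mult_nonneg_nonneg) auto
    ultimately show "\<exists>z. (L has_real_derivative z) (at x) \<and> 0 \<le> z" by blast
  qed
  have Um: "U x \<ge> U x'" if "x \<le> x'" for x x'
  proof (rule DERIV_nonpos_imp_nonincreasing[OF that])
    fix x
    have "(U has_real_derivative exp (- I x) * (b x - M * a x) / c x) (at x)"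
      unfolding U_def by (rule derivative_eq_intros W I refl)+ (use pos(2)[of x]
      in \<open>simp add: field_simps\<close>)
    moreover have "exp (- I x) * (b x - M * a x) / c x \<le> 0"
      using b[of x] pos(2)[of x] by (intro divide_nonpos_pos mult_nonneg_nonpos) auto
    ultimately show "\<exists>z. (U has_real_derivative z) (at x) \<and> z \<le> 0" by blast
  qed
  have "0 \<le> M * a 0" using b[of 0] by linarith
  then have M: "0 \<le> M" using pos(1)[of 0] by (simp add: zero_le_mult_iff)
  have LU: "L x \<le> U x" for x using M by (simp add: L_def U_def)
  have LU2: "L x \<le> U x'" for x x'
    by (cases "x \<le> x'") (use Lm[of x x'] Um[of x' x] LU[of x] LU[of x'] in auto)
  define w where "w = Sup (range L)"
  have "bdd_above (range L)" using LU2[of _ 0] by (auto simp: bdd_above_def)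
  then have w1: "L x \<le> w" for x unfolding w_def by (auto intro: cSup_upper)
  have w2: "w \<le> U x" for x unfolding w_def using LU2[of _ x] by (auto intro!: cSup_least)
  define y where "y = (\<lambda>x. exp (I x) * (w - W x))"
  have "\<bar>y x\<bar> \<le> M" for x
  proof -
    have "\<bar>w - W x\<bar> \<le> M * exp (- I x)" using w1[of x] w2[of x] by (auto simp: L_def U_def)
    then have "\<bar>y x\<bar> \<le> exp (I x) * (M * exp (- I x))" by (simp add: y_def abs_mult)
    also have "\<dots> = M" by (simp add: exp_minus)
    finally show ?thesis .
  qed
  moreover have "(y has_real_derivative (a x * y x - b x) / c x) (at x)" for x
    unfolding y_def by (rule derivative_eq_intros W I refl)+
      (use pos(2)[of x] in \<open>simp add: field_simps exp_minus\<close>)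
  ultimately have "bsol_up a b c y" unfolding bsol_up_def bounded_iff by auto
  then show ?thesis by blast
qed

text \<open>An unspecified function if no bounded solution exists; under
  \<open>dominates a c\<close> there is at most one, so the choice is then unambiguous.\<close>

definition solve_up where "solve_up a b c = (SOME y. bsol_up a b c y)"

lemma bsol_up_solve_up:
  assumes "dominates a c" "continuous_on UNIV b" "\<And>x. \<bar>b x\<bar> \<le> M * a x"
  shows "bsol_up a b c (solve_up a b c)"
  unfolding solve_up_def using bsol_up_exists[OF assms] by (rule someI_ex)

section \<open>The reflected equation and comparison principles\<close>

definition flip :: "(real \<Rightarrow> real) \<Rightarrow> real \<Rightarrow> real" where "flip f x
    = f (- x)"

lemma flip_flip [simp]: "flip (flip f) = f" by (simp add: flip_def fun_eq_iff)

text \<open>In the original variable this is \<open>c y' = b - a y\<close>, whose bounded solution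
  averages \<open>b / a\<close> over the points to the left.\<close>

definition bsol_down where
    "bsol_down a b c y \<longleftrightarrow> bsol_up (flip a) (flip b) (flip c) (flip y)"
definition solve_down where "solve_down a b c = flip (solve_up (flip a) (flip b) (flip c))"

lemma bsol_down_solve_down:
  assumes "dominates (flip a) (flip c)" "continuous_on UNIV b" "\<And>x. \<bar>b x\<bar> \<le> M * a x"
  shows "bsol_down a b c (solve_down a b c)"
  unfolding bsol_down_def solve_down_def flip_flip
  by (rule bsol_up_solve_up[OF assms(1), of _ M])
    (use assms(2,3) in \<open>auto simp: flip_def[abs_def]
    intro!: continuous_on_compose2[OF assms(2)] continuous_intros\<close>)

lemma bsol_down_deriv:
  assumes "bsol_down a b c y"
  shows "(y has_real_derivative (b x - a x * y x) / c x) (at x)"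
proof -
  have *: "(flip y has_real_derivative (a x * y x - b x) / c x) (at (- x))"
    using assms by (auto simp: bsol_down_def bsol_up_def flip_def dest: spec[of _ "-x"])
  have "((\<lambda>x. flip y (- x)) has_real_derivative (a x * y x - b x) / c x * (- 1)) (at x)"
    by (rule DERIV_chain2[where f = "flip y" and g = uminus, OF *]) (auto intro!: derivative_eq_intros)
  then show ?thesis by (simp add: flip_def minus_divide_left)
qed

lemma bsol_up_deriv:
    "bsol_up a b c y \<Longrightarrow> (y has_real_derivative (a x * y x - b x) / c x) (at x)"
  by (simp add: bsol_up_def)

lemma bsol_up_cont: "bsol_up a b c y \<Longrightarrow> continuous_on UNIV y"
  by (meson DERIV_isCont continuous_at_imp_continuous_on bsol_up_deriv)

lemma bsol_down_cont: "bsol_down a b c y \<Longrightarrow> continuous_on UNIV y"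
  by (meson DERIV_isCont continuous_at_imp_continuous_on bsol_down_deriv)

lemma bsol_down_diff:
  assumes "dominates (flip a1) (flip c1)" "bsol_down a1 b1 c1 y1" "bsol_down a2 b2 c2 y2"
      "\<And>x. c2 x \<noteq> 0"
    and "\<And>x. \<bar>b1 x - b2 x - (a1 x - a2 x) * y2 x
    + (c1 x / c2 x - 1) * (a2 x * y2 x - b2 x)\<bar> \<le> M * a1 x"
  shows "\<bar>y1 x - y2 x\<bar> \<le> M"
  using bsol_up_diff[OF assms(1) assms(2,3)[unfolded bsol_down_def], of M "-x"] assms(4,5)
      by (simp add: flip_def)

text \<open>An average of \<open>b / a\<close> stays as close to the constant \<open>m\<close> as
  \<open>b / a\<close> itself, whatever the weights are. Deviations from \<open>1/3\<close> are
  tracked in this way.\<close>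

lemma bsol_up_dev:
  assumes "dominates a c" "bsol_up a b c y" "\<And>x. \<bar>b x - m * a x\<bar> \<le> M * a x"
  shows "\<bar>y x - m\<bar> \<le> M"
proof -
  have "b x \<le> (m + M) * a x" "(m - M) * a x \<le> b x" for x
    using assms(3)[of x] by (auto simp: algebra_simps abs_le_iff)
  then have "y x \<le> m + M" "m - M \<le> y x"
    by (auto intro!: bsol_up_le[OF assms(1,2)] bsol_up_ge[OF assms(1,2)])
  then show ?thesis by (simp add: abs_le_iff)
qed

lemma bsol_down_dev:
  assumes "dominates (flip a) (flip c)" "bsol_down a b c y" "\<And>x. \<bar>b x - m * a x\<bar> \<le> M * a x"
  shows "\<bar>y x - m\<bar> \<le> M"
  using bsol_up_dev[OF assms(1) assms(2)[unfolded bsol_down_def], of m M "-x"] assms(3)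
      by (simp add: flip_def)

lemma bsol_up_mono:
  assumes "dominates a c" "bsol_up a b1 c y1" "bsol_up a b2 c y2" "\<And>x. b1 x \<le> b2 x"
  shows "y1 x \<le> y2 x"
proof -
  have "bsol_up a (\<lambda>x. b1 x - b2 x) c (\<lambda>x. y1 x - y2 x)"
    unfolding bsol_up_def
  proof (intro conjI allI)
    show "bounded (range (\<lambda>x. y1 x - y2 x))"
      using assms by (auto simp: bsol_up_def intro: bounded_minus_comp)
    show "((\<lambda>x. y1 x - y2 x) has_real_derivative (a x * (y1 x - y2 x) - (b1 x - b2 x)) / c x)
        (at x)" for x
      by (rule DERIV_cong[OF DERIV_diff[OF bsol_up_deriv[OF assms(2)] bsol_up_deriv[OF assms(3)]]])
        (simp add: diff_divide_distrib[symmetric] algebra_simps)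
  qed
  from bsol_up_le[OF assms(1) this, of 0 x] assms(4) show ?thesis by simp
qed

lemma bsol_down_mono:
  assumes "dominates (flip a) (flip c)" "bsol_down a b1 c y1" "bsol_down a b2 c y2" "\<And>x. b1 x \<le> b2 x"
  shows "y1 x \<le> y2 x"
  using bsol_up_mono[OF assms(1) assms(2,3)[unfolded bsol_down_def], of "-x"] assms(4) by (simp add: flip_def)

section \<open>Averages to the left and to the right of a point\<close>

lemma dominates_logistic: "dominates logistic (\<lambda>_. 1)"
  unfolding dominates_def by (auto simp: logistic_pos intro!: exI[of _ 1] continuous_intros)

lemma flip_1_logistic: "flip (\<lambda>x. 1 - logistic x) = logistic" and flip_const: "flip
    (\<lambda>_. c) = (\<lambda>_. c)"
  by (auto simp: flip_def logistic_minus)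

text \<open>With \<open>z = logistic x\<close> one has \<open>dz = z (1 - z) dx\<close>, so
  \<open>y' = z (y - f)\<close> becomes \<open>d/dz ((1 - z) y) = - f\<close>: the bounded solution
  is the mean of \<open>f\<close> over \<open>(z, 1)\<close>. In the same way
  \<open>left_avg\<close> is the mean over \<open>(0, z)\<close>.\<close>

definition right_avg where "right_avg f = solve_up logistic (\<lambda>x. logistic x * f x) (\<lambda>_. 1)"
definition left_avg where "left_avg f = solve_down (\<lambda>x. 1 - logistic x)
    (\<lambda>x. (1 - logistic x) * f x) (\<lambda>_. 1)"

definition bcont :: "(real \<Rightarrow> real) \<Rightarrow> bool" where
  "bcont f \<longleftrightarrow> continuous_on UNIV f \<and> bounded (range f)"

lemma bcont_logistic_mult:
  assumes "bcont f"
  shows "bcont (\<lambda>x. logistic x * f x)" "bcont (\<lambda>x. (1 - logistic x) * f x)"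
proof -
  from assms obtain M where M: "\<bar>f x\<bar> \<le> M" for x by (auto simp: bcont_def bounded_iff)
  have 1: "\<bar>logistic x * f x\<bar> \<le> M" "\<bar>(1 - logistic x) * f x\<bar> \<le> M" for x
    using mult_mono[of "logistic x" 1 "\<bar>f x\<bar>" M] mult_mono[of "1 - logistic x" 1
    "\<bar>f x\<bar>" M] M[of x] logistic_pos[of x] logistic_less_1[of x]
    by (auto simp: abs_mult)
  show "bcont (\<lambda>x. logistic x * f x)" "bcont (\<lambda>x. (1 - logistic x) * f x)"
    using assms 1 by (auto simp: bcont_def bounded_iff intro!: continuous_intros)
qed

lemma bsol_up_right_avg: "bcont f \<Longrightarrow> bsol_up logistic (\<lambda>x. logistic x * f x)
    (\<lambda>_. 1) (right_avg f)"
  unfolding right_avg_def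
proof -
  assume f: "bcont f"
  then obtain M where M: "\<bar>f x\<bar> \<le> M" for x by (auto simp: bcont_def bounded_iff)
  show "bsol_up logistic (\<lambda>x. logistic x * f x) (\<lambda>_. 1) (solve_up logistic
      (\<lambda>x. logistic x * f x) (\<lambda>_. 1))"
    by (rule bsol_up_solve_up[OF dominates_logistic, of _ M])
      (use f M logistic_pos in \<open>auto simp: bcont_def abs_mult less_imp_le mult.commute[of M]
      intro!: continuous_intros mult_left_mono\<close>)
qed

lemma bsol_down_left_avg: "bcont f \<Longrightarrow> bsol_down (\<lambda>x. 1 - logistic x)
    (\<lambda>x. (1 - logistic x) * f x) (\<lambda>_. 1) (left_avg f)"
  unfolding left_avg_def
proof -
  assume f: "bcont f"
  then obtain M where M: "\<bar>f x\<bar> \<le> M" for x by (auto simp: bcont_def bounded_iff)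
  show "bsol_down (\<lambda>x. 1 - logistic x) (\<lambda>x. (1 - logistic x) * f x)
      (\<lambda>_. 1) (solve_down (\<lambda>x. 1 - logistic x) (\<lambda>x. (1 - logistic x) * f x)
      (\<lambda>_. 1))"
    by (rule bsol_down_solve_down[of _ _ _ M])
      (use f M logistic_less_1 dominates_logistic in \<open>auto
      simp: flip_1_logistic flip_const bcont_def abs_mult less_imp_le mult.commute[of M]
      intro!: continuous_intros mult_left_mono\<close>)
qed

lemma right_avg_deriv:
    "bcont f \<Longrightarrow> (right_avg f has_real_derivative logistic x * (right_avg f x - f x)) (at x)"
  by (rule DERIV_cong[OF bsol_up_deriv[OF bsol_up_right_avg]]) (auto simp: algebra_simps)

lemma left_avg_deriv:
    "bcont f \<Longrightarrow> (left_avg f has_real_derivative (1 - logistic x) * (f x - left_avg f x))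
    (at x)"
  by (rule DERIV_cong[OF bsol_down_deriv[OF bsol_down_left_avg]]) (auto simp: algebra_simps)

lemma right_avg_cont: "bcont f \<Longrightarrow> continuous_on UNIV (right_avg f)"
  and left_avg_cont: "bcont f \<Longrightarrow> continuous_on UNIV (left_avg f)"
  by (rule bsol_up_cont[OF bsol_up_right_avg] bsol_down_cont[OF bsol_down_left_avg]; assumption)+

lemma right_avg_dev: "bcont f \<Longrightarrow> (\<And>x. \<bar>f x - m\<bar>
    \<le> M) \<Longrightarrow> \<bar>right_avg f x - m\<bar> \<le> M"
proof (rule bsol_up_dev[OF dominates_logistic bsol_up_right_avg], assumption)
  fix y assume f: "\<And>x. \<bar>f x - m\<bar> \<le> M"
  have "logistic y * f y - m * logistic y = logistic y * (f y - m)" by (simp add: algebra_simps)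
  then show "\<bar>logistic y * f y - m * logistic y\<bar> \<le> M * logistic y"
    using f[of y] logistic_pos[of y] by (simp add: abs_mult)
qed

lemma left_avg_dev: "bcont f \<Longrightarrow> (\<And>x. \<bar>f x - m\<bar>
    \<le> M) \<Longrightarrow> \<bar>left_avg f x - m\<bar> \<le> M"
proof (rule bsol_down_dev[OF _ bsol_down_left_avg], simp add: flip_1_logistic flip_const
    dominates_logistic, assumption)
  fix y assume f: "\<And>x. \<bar>f x - m\<bar> \<le> M"
  have "(1 - logistic y) * f y - m * (1 - logistic y) = (1 - logistic y) * (f y - m)"
      by (simp add: algebra_simps)
  then show "\<bar>(1 - logistic y) * f y - m * (1 - logistic y)\<bar> \<le> M * (1 - logistic y)"
    using f[of y] logistic_less_1[of y] by (simp add: abs_mult)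
qed

lemma right_avg_diff:
  assumes "bcont f1" "bcont f2" "\<And>x. \<bar>f1 x - f2 x\<bar> \<le> M"
  shows "\<bar>right_avg f1 x - right_avg f2 x\<bar> \<le> M"
proof (rule bsol_up_diff[OF dominates_logistic bsol_up_right_avg bsol_up_right_avg, OF assms(1,2)])
  fix y
  have "logistic y * f1 y - logistic y * f2 y = logistic y * (f1 y - f2 y)" by (simp add: algebra_simps)
  then show "\<bar>logistic y * f1 y - logistic y * f2 y - (logistic y - logistic y) * right_avg f2 y +
         (1 / 1 - 1) * (logistic y * right_avg f2 y - logistic y * f2 y)\<bar> \<le> M * logistic y"
    using assms(3)[of y] logistic_pos[of y] by (simp add: abs_mult)
qed simp

lemma left_avg_diff:
  assumes "bcont f1" "bcont f2" "\<And>x. \<bar>f1 x - f2 x\<bar> \<le> M"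
  shows "\<bar>left_avg f1 x - left_avg f2 x\<bar> \<le> M"
proof (rule bsol_down_diff[OF _ bsol_down_left_avg bsol_down_left_avg, OF _ assms(1,2)])
  fix y
  have "(1 - logistic y) * f1 y - (1 - logistic y) * f2 y = (1 - logistic y) * (f1 y - f2 y)"
      by (simp add: algebra_simps)
  then show "\<bar>(1 - logistic y) * f1 y - (1 - logistic y) * f2 y - (1 - logistic y - (1 - logistic
      y)) * left_avg f2 y +
         (1 / 1 - 1) * ((1 - logistic y) * left_avg f2 y - (1 - logistic y) * f2 y)\<bar>
         \<le> M * (1 - logistic y)"
    using assms(3)[of y] logistic_less_1[of y] by (simp add: abs_mult)
qed (simp_all add: flip_1_logistic flip_const dominates_logistic)

text \<open>A closed ball in the sup norm; \<open>1/3\<close> is the limiting value of both unknowns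
  \<open>g\<close> and \<open>k\<close> as \<open>l\<close> tends to 0.\<close>

definition near :: "real \<Rightarrow> (real \<Rightarrow> real) \<Rightarrow> bool" where
  "near b g \<longleftrightarrow> continuous_on UNIV g \<and> (\<forall>x. \<bar>g x - 1/3\<bar> \<le> b)"

lemma near_bcont: "near b g \<Longrightarrow> bcont g"
proof -
  assume "near b g"
  then have "continuous_on UNIV g" "\<bar>g x\<bar> \<le> b + 1/3" for x
    by (auto simp: near_def dest!: spec[of _ x])
  then show ?thesis by (auto simp: bcont_def bounded_iff)
qed

subsection \<open>The functionals of the slope of $u$\<close>

text \<open>
  Functions of $z \in (0,1)$ are written as functions of $x$ with $z = \mathit{logistic}\ x$, so
  \<open>left_avg g\<close> is $\frac1z \int_0^z g$, \<open>right_avg g\<close> is $\frac1{1-z} \int_z^1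
      g$, and
  \<open>total_drop g\<close> is $\int_0^1 g$ (split at $x = 0$, i.e. $z = 1/2$). If $P'' = -g$ and
  $P(0) = P(1) = 0$, then \<open>speed g\<close> is $P / (z(1-z))$ and \<open>slope g\<close> is $dP/dz$.
  The parameter \<open>b\<close> stands for $l/\sqrt2$.
\<close>

definition left_moment where "left_moment g = left_avg (\<lambda>x. logistic x * g x)"
definition right_moment where "right_moment g = right_avg (\<lambda>x. (1 - logistic x) * g x)"
definition speed where "speed g x = left_moment g x + right_moment g x"
definition slope where "slope g x = (1 - logistic x) * right_moment g x - logistic x * left_moment g x"
definition total_drop where "total_drop g = (left_avg g 0 + right_avg g 0) / 2"
definition layer_width where "layer_width b g = b / (1 - total_drop g)"

text \<open>For a constant \<open>c\<close> in place of \<open>g\<close> the moment is exactly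
  \<open>c * logistic x / 2\<close>, and averaging is monotone, so comparison with the constants
  \<open>1/3 - b\<close> and \<open>1/3 + b\<close> suffices. Keeping the factor
  \<open>logistic x\<close> in the error lets the errors of the two moments add up to just
  \<open>b / 2\<close> in \<open>speed_dev\<close>.\<close>

lemma left_moment_dev:
  assumes "near b g"
  shows "\<bar>left_moment g x - logistic x / 6\<bar> \<le> b * logistic x / 2"
proof -
  have s: "bsol_down (\<lambda>x. 1 - logistic x) (\<lambda>x. (1 - logistic x) * (logistic x * c))
      (\<lambda>_. 1) (\<lambda>x. c * logistic x / 2)" for c
    unfolding bsol_down_def bsol_up_def flip_def logistic_minus
  proof (intro conjI allI)
    have "\<bar>c * (1 - logistic x) / 2\<bar> \<le> \<bar>c\<bar>" for x
      using mult_left_mono[of "1 - logistic x" 1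
      "\<bar>c\<bar>"] logistic_pos[of x] logistic_less_1[of x] by (simp add: abs_mult)
    then show "bounded (range (\<lambda>x. c * (1 - logistic x) / 2))" by (auto simp: bounded_iff)
  qed (auto intro!: derivative_eq_intros simp: field_simps)
  have g: "1/3 - b \<le> g x" "g x \<le> 1/3 + b" for x
    using assms by (auto simp: near_def abs_le_iff algebra_simps dest!: spec[of _ x])
  have d: "dominates (flip (\<lambda>x. 1 - logistic x)) (flip (\<lambda>_. 1))"
      by (simp add: flip_1_logistic flip_const dominates_logistic)
  note X = bsol_down_left_avg[OF bcont_logistic_mult(1)[OF near_bcont[OF assms]], folded left_moment_def]
  have "(1/3 - b) * logistic x / 2 \<le> left_moment g x"
    by (rule bsol_down_mono[OF d s X])
      (use g logistic_pos logistic_less_1 in \<open>auto intro!: mult_left_mono simp: less_imp_le\<close>)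
  moreover have "left_moment g x \<le> (1/3 + b) * logistic x / 2"
    by (rule bsol_down_mono[OF d X s])
      (use g logistic_pos logistic_less_1 in \<open>auto intro!: mult_left_mono simp: less_imp_le\<close>)
  ultimately show ?thesis by (simp add: abs_le_iff field_simps)
qed

lemma right_moment_dev:
  assumes "near b g"
  shows "\<bar>right_moment g x - (1 - logistic x) / 6\<bar> \<le> b * (1 - logistic x) / 2"
proof -
  have s: "bsol_up logistic (\<lambda>x. logistic x * ((1 - logistic x) * c)) (\<lambda>_. 1)
      (\<lambda>x. c * (1 - logistic x) / 2)" for c
    unfolding bsol_up_def 
  proof (intro conjI allI)
    have "\<bar>c * (1 - logistic x) / 2\<bar> \<le> \<bar>c\<bar>" for x
      using mult_left_mono[of "1 - logistic x" 1
      "\<bar>c\<bar>"] logistic_pos[of x] logistic_less_1[of x] by (simp add: abs_mult)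
    then show "bounded (range (\<lambda>x. c * (1 - logistic x) / 2))" by (auto simp: bounded_iff)
  qed (auto intro!: derivative_eq_intros simp: field_simps)
  have g: "1/3 - b \<le> g x" "g x \<le> 1/3 + b" for x
    using assms by (auto simp: near_def abs_le_iff algebra_simps dest!: spec[of _ x])
  note Y = bsol_up_right_avg[OF bcont_logistic_mult(2)[OF near_bcont[OF assms]], folded right_moment_def]
  have "(1/3 - b) * (1 - logistic x) / 2 \<le> right_moment g x"
    by (rule bsol_up_mono[OF dominates_logistic s Y])
      (use g logistic_pos logistic_less_1 in \<open>auto intro!: mult_left_mono simp: less_imp_le\<close>)
  moreover have "right_moment g x \<le> (1/3 + b) * (1 - logistic x) / 2"
    by (rule bsol_up_mono[OF dominates_logistic Y s])
      (use g logistic_pos logistic_less_1 in \<open>auto intro!: mult_left_mono simp: less_imp_le\<close>)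
  ultimately show ?thesis by (simp add: abs_le_iff field_simps)
qed

lemma speed_dev:
  assumes "near b g"
  shows "\<bar>speed g x - 1/6\<bar> \<le> b/2"
  using left_moment_dev[OF assms, of x] right_moment_dev[OF assms, of x] unfolding speed_def
  by (auto simp: abs_le_iff field_simps)

lemma speed_bounds:
  assumes "near b g" "b \<le> 1/1000"
  shows "3/20 \<le> speed g x" "speed g x \<le> 1/5"
  using speed_dev[OF assms(1), of x] assms(2) by linarith+

lemma XY_bounds:
  assumes "near b g" "b \<le> 1/1000"
  shows "0 \<le> left_moment g x" "left_moment g x \<le> 1/5" "0 \<le> right_moment g x"
      "right_moment g x \<le> 1/5"
proof -
  have "b * logistic x \<le> logistic x / 1000" "b * (1 - logistic x) \<le> (1 - logistic x) / 1000"
    using mult_right_mono[OF assms(2), of "logistic x"] mult_right_mono[OF assms(2), of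
    "1 - logistic x"] logistic_pos[of x] logistic_less_1[of x]
    by auto
  then show "0 \<le> left_moment g x" "left_moment g x \<le> 1/5" "0 \<le> right_moment g x"
      "right_moment g x \<le> 1/5"
    using left_moment_dev[OF assms(1), of x] right_moment_dev[OF assms(1), of x] logistic_pos[of x]
    logistic_less_1[of x]
    unfolding abs_le_iff diff_divide_distrib by linarith+
qed

lemma slope_bound:
  assumes "near b g" "b \<le> 1/1000"
  shows "\<bar>slope g x\<bar> \<le> 1/5"
proof -
  note xy = XY_bounds[OF assms, of x] 
  have "(1 - logistic x) * right_moment g x \<le> 1 * (1/5)" "logistic x * left_moment g x
      \<le> 1 * (1/5)" "0 \<le> (1 - logistic x) * right_moment g x" "0 \<le> logistic x * left_moment g x"
    using xy logistic_pos[of x] logistic_less_1[of x] by (intro mult_mono mult_nonneg_nonneg; simp)+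
  then show ?thesis unfolding slope_def by linarith
qed

lemma total_drop_dev:
  assumes "near b g"
  shows "\<bar>total_drop g - 1/3\<bar> \<le> b"
proof -
  have "\<bar>g x - 1/3\<bar> \<le> b" for x using assms by (simp add: near_def)
  then have "\<bar>right_avg g 0 - 1/3\<bar> \<le> b" "\<bar>left_avg g 0 - 1/3\<bar> \<le> b"
    by (auto intro!: right_avg_dev left_avg_dev near_bcont[OF assms])
  then show ?thesis unfolding total_drop_def add_divide_distrib by linarith
qed

lemma layer_width_bounds:
  assumes "near b g" "b \<le> 1/1000" "0 < b"
  shows "0 < layer_width b g" "layer_width b g \<le> 2 * b"
proof -
  have "1/2 \<le> 1 - total_drop g" using total_drop_dev[OF assms(1)] assms(2) by (auto simp: abs_le_iff)
  then show "0 < layer_width b g" "layer_width b g \<le> 2 * b" using assms(3) mult_left_mono[of "1/2"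
      "1 - total_drop g" "b * 2"]
    unfolding layer_width_def by (auto simp: field_simps)
qed

section \<open>Lipschitz dependence of the functionals on \<open>g\<close>\<close>

lemma speed_diff:
  assumes "near b g1" "near b g2" "\<And>x. \<bar>g1 x - g2 x\<bar> \<le> D"
  shows "\<bar>speed g1 x - speed g2 x\<bar> \<le> 2 * D" "\<bar>slope g1 x - slope g2 x\<bar> \<le> D"
proof -
  note bc = near_bcont[OF assms(1)] near_bcont[OF assms(2)]
  have D: "0 \<le> D" using assms(3)[of 0] by linarith
  have l: "\<bar>logistic x * g1 x - logistic x * g2 x\<bar> \<le> D"
      "\<bar>(1 - logistic x) * g1 x - (1 - logistic x) * g2 x\<bar> \<le> D" for x
    using mult_mono[of "logistic x" 1 "\<bar>g1 x - g2 x\<bar>" D] mult_mono[of "1 - logistic x" 1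
    "\<bar>g1 x - g2 x\<bar>" D]
      assms(3)[of x] logistic_pos[of x] logistic_less_1[of x] D
    by (auto simp: abs_mult right_diff_distrib[symmetric])
  have X: "\<bar>left_moment g1 x - left_moment g2 x\<bar> \<le> D" and Y:
      "\<bar>right_moment g1 x - right_moment g2 x\<bar> \<le> D" 
    unfolding left_moment_def right_moment_def by (rule left_avg_diff right_avg_diff; use l bc
    in \<open>auto intro: bcont_logistic_mult\<close>)+
  show "\<bar>speed g1 x - speed g2 x\<bar> \<le> 2 * D" using X Y unfolding speed_def by linarith
  have "\<bar>(1 - logistic x) * (right_moment g1 x - right_moment g2 x)\<bar>
      \<le> (1 - logistic x) * D" "\<bar>logistic x * (left_moment g1 x - left_moment g2 x)\<bar>
      \<le> logistic x * D"
    using X Y logistic_pos[of x] logistic_less_1[of x] by (auto simp: abs_mult)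
  then show "\<bar>slope g1 x - slope g2 x\<bar> \<le> D" unfolding slope_def by (auto
      simp: abs_le_iff algebra_simps)
qed

lemma total_drop_diff:
  assumes "near b g1" "near b g2" "\<And>x. \<bar>g1 x - g2 x\<bar> \<le> D"
  shows "\<bar>total_drop g1 - total_drop g2\<bar> \<le> D"
  using right_avg_diff[OF near_bcont near_bcont, OF assms, of 0] left_avg_diff[OF near_bcont near_bcont,
      OF assms, of 0]
  unfolding total_drop_def add_divide_distrib by linarith

text \<open>The relative change serves for quotients of leading coefficients; the absolute change,
  with its extra factor \<open>b\<close>, serves for \<open>defect\<close> and for the product of
  layer width and slope.\<close>

lemma layer_width_diff:
  assumes "near b g1" "near b g2" "\<And>x. \<bar>g1 x - g2 x\<bar> \<le> D" "b \<le> 1/1000" "0 < b"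
  shows "\<bar>layer_width b g1 / layer_width b g2 - 1\<bar> \<le> 2 * D"
      "\<bar>layer_width b g1 - layer_width b g2\<bar> \<le> 4 * b * D"
proof -
  have h: "1/2 \<le> 1 - total_drop g1" using total_drop_dev[OF assms(1)] assms(4) by (auto simp: abs_le_iff)
  have h2: "1/2 \<le> 1 - total_drop g2" using total_drop_dev[OF assms(2)] assms(4) by (auto simp: abs_le_iff)
  note G = total_drop_diff[OF assms(1-3)]
  have D: "0 \<le> D" using assms(3)[of 0] by linarith
  have "layer_width b g1 / layer_width b g2 - 1 = (total_drop g1 - total_drop g2) / (1 - total_drop g1)"
    using h h2 assms(5) unfolding layer_width_def by (simp add: field_simps)
  then have "\<bar>layer_width b g1 / layer_width b g2 - 1\<bar>
      = \<bar>total_drop g1 - total_drop g2\<bar> / (1 - total_drop g1)" using h by simp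
  also have "\<dots> \<le> D / (1/2)" using h D G by (intro frac_le) auto
  finally show 1: "\<bar>layer_width b g1 / layer_width b g2 - 1\<bar> \<le> 2 * D" by simp
  note b2 = layer_width_bounds[OF assms(2,4,5)]
  have "layer_width b g1 - layer_width b g2
      = layer_width b g2 * (layer_width b g1 / layer_width b g2 - 1)" using b2 by (simp add: field_simps)
  then have "\<bar>layer_width b g1 - layer_width b g2\<bar>
      = layer_width b g2 * \<bar>layer_width b g1 / layer_width b g2 - 1\<bar>" using b2
      by (simp add: abs_mult)
  also have "\<dots> \<le> (2 * b) * (2 * D)" using b2 1 by (intro mult_mono) auto
  finally show "\<bar>layer_width b g1 - layer_width b g2\<bar> \<le> 4 * b * D" by simp
qed

subsection \<open>The fixed-point map\<close>

lemma abs_mult_mono: "\<bar>x\<bar> \<le> a \<Longrightarrow> \<bar>y\<bar>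
    \<le> b \<Longrightarrow> \<bar>x * y\<bar> \<le> a * b" for x y a b :: real
  unfolding abs_mult by (rule mult_mono) auto

lemma abs_add_mono: "\<bar>x\<bar> \<le> a \<Longrightarrow> \<bar>y\<bar>
    \<le> b \<Longrightarrow> \<bar>x + y\<bar> \<le> a + b"
  and abs_diff_mono: "\<bar>x\<bar> \<le> a \<Longrightarrow> \<bar>y\<bar>
      \<le> b \<Longrightarrow> \<bar>x - y\<bar> \<le> a + b"
  and abs_le_addI: "\<bar>x - y\<bar> \<le> a \<Longrightarrow> 0
      \<le> y \<Longrightarrow> \<bar>x\<bar> \<le> y + a" for x y a b :: real
  by linarith+

lemma dominates_halfI:
  assumes "continuous_on UNIV a" "continuous_on UNIV c" "\<And>x. 1/2 \<le> a x" "\<And>x. 0 < c x"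
      "\<And>x. c x \<le> 1/2"
  shows "dominates a c"
  unfolding dominates_def
proof (intro conjI allI exI[of _ "1::real"])
  fix x
  show "0 < a x" using assms(3)[of x] by linarith
  have "1 \<le> a x / c x" using assms(3-5)[of x] by (simp add: field_simps)
  then show "1 * logistic x \<le> a x / c x" using logistic_less_1[of x] by simp
qed (use assms in auto)

text \<open>
  With $G = \int_0^z g$ and $S = dP/dz$, in the wave coordinate
  $r' = 2Gr - gd$ where $d = 2G - 2\beta P(k-g)$ is the rescaled $c_1 - c_2$,
  $\beta k' = (1 - \beta S)k - (1-r)/2$ and $\beta g' = k - (1 + \beta S)g$. The last two combine to
  $m - \beta^2 m'' = P(1-r)/2$ for $m = Pg$, the differentiated equation for $u$.
\<close>

definition defect where "defect b g k x = layer_width b g * (1 - logistic x) * speed g x * (k x - g x)"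
definition ratio_map where "ratio_map b g k = solve_up (\<lambda>x. logistic x * left_avg g x)
    (\<lambda>x. logistic x * (g x * (left_avg g x - defect b g k x))) (\<lambda>x. speed g x / 2)"
definition inner_map where "inner_map b g k = solve_up (\<lambda>x. 1 - layer_width b g * slope g x)
    (\<lambda>x. (1 - ratio_map b g k x) / 2) (\<lambda>x. layer_width b g * speed g x)"
definition outer_map where "outer_map b g k = solve_down (\<lambda>x. 1
    + layer_width b g * slope g x) (inner_map b g k) (\<lambda>x. layer_width b g * speed g x)"

locale near_pair =
  fixes b :: real and g k :: "real \<Rightarrow> real"
  assumes b: "0 < b" "b \<le> 1/1000" and g: "near b g" and k: "near b k"
begin

abbreviation "\<beta> \<equiv> layer_width b g"

lemma bounds: "\<bar>g x - 1/3\<bar> \<le> b" "\<bar>k x - 1/3\<bar> \<le> b"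
    "\<bar>left_avg g x - 1/3\<bar> \<le> b" "3/10 \<le> g x" "g x \<le> 4/10" "\<bar>g x\<bar> \<le> 4/10"
  "3/10 \<le> left_avg g x" "left_avg g x \<le> 4/10" "\<bar>left_avg g x\<bar> \<le> 4/10"
      "0 < speed g x" "\<bar>speed g x\<bar> \<le> 1/5" "\<bar>k x - g x\<bar> \<le> 2 * b"
proof -
  show 1: "\<bar>g x - 1/3\<bar> \<le> b" "\<bar>k x - 1/3\<bar> \<le> b" for x
    using g k by (auto simp: near_def)
  show 2: "\<bar>left_avg g x - 1/3\<bar> \<le> b" by (rule left_avg_dev[OF near_bcont[OF g] 1(1)])
  show "3/10 \<le> g x" "g x \<le> 4/10" "\<bar>g x\<bar> \<le> 4/10"
    "3/10 \<le> left_avg g x" "left_avg g x \<le> 4/10" "\<bar>left_avg g x\<bar> \<le> 4/10"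
    "\<bar>k x - g x\<bar> \<le> 2 * b"
    using 1[of x] 2 b by linarith+
  show "0 < speed g x" "\<bar>speed g x\<bar> \<le> 1/5" using speed_bounds[OF g b(2), of x] by linarith+
qed

lemma beta: "0 < \<beta>" "\<beta> \<le> 2 * b" "\<bar>\<beta>\<bar> \<le> 2 * b" "b \<le> \<beta>"
proof -
  show 1: "0 < \<beta>" "\<beta> \<le> 2 * b" by (rule layer_width_bounds[OF g b(2,1)])+
  then show "\<bar>\<beta>\<bar> \<le> 2 * b" by simp
  have "0 < 1 - total_drop g" "1 - total_drop g \<le> 1" using total_drop_dev[OF g] b by linarith+
  then show "b \<le> \<beta>" using b(1) by (simp add: layer_width_def field_simps)
qed

lemma beta_slope: "\<bar>\<beta> * slope g x\<bar> \<le> 2/5 * b" "1/2 \<le> 1 - \<beta> * slope g x"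
    "1/2 \<le> 1 + \<beta> * slope g x"
proof -
  show "\<bar>\<beta> * slope g x\<bar> \<le> 2/5 * b"
      using abs_mult_mono[OF beta(3) slope_bound[OF g b(2), of x]] by simp
  then show "1/2 \<le> 1 - \<beta> * slope g x" "1/2 \<le> 1 + \<beta> * slope g x" using b by linarith+
qed

lemma beta_speed: "0 < \<beta> * speed g x" "\<beta> * speed g x \<le> 1/2"
proof -
  show "0 < \<beta> * speed g x" using beta bounds by simp
  show "\<beta> * speed g x \<le> 1/2" using abs_mult_mono[OF beta(3) bounds(11), of x] b by linarith
qed

text \<open>Both \<open>\<beta>\<close> and \<open>k - g\<close> are of order \<open>b\<close>, so
  the defect is quadratic in \<open>b\<close>; one factor is absorbed by
  \<open>b \<le> 1/1000\<close>.\<close>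

lemma defect_bound: "\<bar>defect b g k x\<bar> \<le> b / 1000"
proof -
  have "\<bar>1 - logistic x\<bar> \<le> 1" using logistic_pos[of x] logistic_less_1[of x] by simp
  note abs_mult_mono[OF abs_mult_mono[OF abs_mult_mono[OF beta(3) this] bounds(11)[of x]] bounds(12)[of x]]
  moreover have "b * b \<le> b * (1/1000)" using b by (intro mult_left_mono) auto
  ultimately show ?thesis unfolding defect_def by linarith
qed

lemma cont: "continuous_on UNIV g" "continuous_on UNIV k" "continuous_on UNIV (left_avg g)"
    "continuous_on UNIV (speed g)"
  "continuous_on UNIV (slope g)" "continuous_on UNIV (defect b g k)"
proof -
  note bc = near_bcont[OF g]
  show 1: "continuous_on UNIV g" "continuous_on UNIV k" using g k by (auto simp: near_def)
  show 2: "continuous_on UNIV (left_avg g)" by (rule left_avg_cont[OF bc])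
  have XY: "continuous_on UNIV (left_moment g)" "continuous_on UNIV (right_moment g)"
    unfolding left_moment_def right_moment_def by (intro left_avg_cont right_avg_cont bcont_logistic_mult bc)+
  show 3: "continuous_on UNIV (speed g)" 
    using XY unfolding speed_def[abs_def] by (intro continuous_intros)
  show "continuous_on UNIV (slope g)" 
    using XY unfolding slope_def[abs_def] by (intro continuous_intros)
  show "continuous_on UNIV (defect b g k)"
    unfolding defect_def[abs_def] by (intro continuous_intros 1 3)
qed

text \<open>The coefficient vanishes like \<open>logistic\<close> at the left end, where
  \<open>u\<close> starts from 0; the bound in \<open>dominates\<close> is shaped to admit this. It
  holds with \<open>e = 1\<close>, since \<open>left_avg g\<close> is about \<open>1/3\<close> and
  half the speed about \<open>1/12\<close>.\<close>

lemma dom_ratio_map: "dominates (\<lambda>x. logistic x * left_avg g x) (\<lambda>x. speed g x / 2)"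
  unfolding dominates_def
proof (intro conjI allI exI[of _ "1::real"])
  fix x
  show "0 < logistic x * left_avg g x" using bounds[of x] logistic_pos[of x] by simp
  have "speed g x / 2 \<le> left_avg g x" using bounds[of x] by linarith
  then have "logistic x * (speed g x / 2) \<le> logistic x * left_avg g x" using logistic_pos[of x]
      by (intro mult_left_mono) auto
  then show "1 * logistic x \<le> logistic x * left_avg g x / (speed g x / 2)" using bounds[of x] 
    by (simp add: field_simps)
qed (use bounds in \<open>auto intro!: continuous_intros cont\<close>)

text \<open>Divided by its coefficient the source is \<open>g * (1 - defect / left_avg)\<close>. The
  factor \<open>g\<close> deviates from \<open>1/3\<close> by at most \<open>b\<close>, and the
  quadratically small defect fits into the remaining \<open>b / 10\<close>.\<close>

lemma ratio_map_rhs: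
    "\<bar>logistic x * (g x * (left_avg g x - defect b g k x)) - 1/3 * (logistic x * left_avg g
    x)\<bar> \<le> 11/10 * b * (logistic x * left_avg g x)"
proof -
  have 1: "\<bar>g x * defect b g k x\<bar> \<le> 4/10 * (b/1000)" using bounds defect_bound
      by (intro abs_mult_mono) auto
  have 2: "\<bar>left_avg g x * (g x - 1/3)\<bar> \<le> left_avg g x * b"
    using bounds[of x] by (auto simp: abs_mult intro!: mult_mono)
  have "b * (3/10) \<le> b * left_avg g x" using bounds[of x] b by (intro mult_left_mono) auto
  then have 3: "left_avg g x * b + 4/10 * (b/1000) \<le> 11/10 * (b * left_avg g x)"
    using b by (simp add: mult.commute)
  have 4: "g x * (left_avg g x - defect b g k x) - 1/3 * left_avg g x
      = left_avg g x * (g x - 1/3) - g x * defect b g k x"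
    by (simp add: algebra_simps)
  have "\<bar>g x * (left_avg g x - defect b g k x) - 1/3 * left_avg g x\<bar>
      \<le> 11/10 * (b * left_avg g x)"
    unfolding 4 by (rule order_trans[OF abs_diff_mono[OF 2 1] 3])
  then have "logistic x * \<bar>g x * (left_avg g x - defect b g k x) - 1/3 * left_avg g x\<bar>
      \<le> logistic x * (11/10 * (b * left_avg g x))"
    using logistic_pos[of x] by (intro mult_left_mono) auto
  also have "logistic x * \<bar>g x * (left_avg g x - defect b g k x) - 1/3 * left_avg g x\<bar>
      = \<bar>logistic x * (g x * (left_avg g x - defect b g k x) - 1/3 * left_avg g x)\<bar>"
    using logistic_pos[of x] by (simp add: abs_mult)
  finally show ?thesis by (simp add: algebra_simps)
qed

lemma ratio_map_sol: "bsol_up (\<lambda>x. logistic x * left_avg g x)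
    (\<lambda>x. logistic x * (g x * (left_avg g x - defect b g k x)))
    (\<lambda>x. speed g x / 2) (ratio_map b g k)"
  unfolding ratio_map_def
proof (rule bsol_up_solve_up[OF dom_ratio_map, of _ "1/3 + 11/10 * b"])
  show "continuous_on UNIV (\<lambda>x. logistic x * (g x * (left_avg g x - defect b g k x)))"
    by (intro continuous_intros cont)
  fix x
  have "0 < logistic x * left_avg g x" using bounds[of x] logistic_pos[of x] by simp
  then show "\<bar>logistic x * (g x * (left_avg g x - defect b g k x))\<bar> \<le> (1/3
      + 11/10 * b) * (logistic x * left_avg g x)"
    using ratio_map_rhs[of x] unfolding distrib_right by linarith
qed

lemma ratio_map_dev: "\<bar>ratio_map b g k x - 1/3\<bar> \<le> 11/10 * b"
  by (rule bsol_up_dev[OF dom_ratio_map ratio_map_sol ratio_map_rhs])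

lemma dom_inner_map: "dominates (\<lambda>x. 1 - \<beta> * slope g x) (\<lambda>x. \<beta> * speed g x)"
  by (rule dominates_halfI) (use beta_slope beta_speed in \<open>auto intro!: continuous_intros cont\<close>)

text \<open>The map taking \<open>r\<close> to \<open>(1 - r) / 2\<close> fixes \<open>1/3\<close>
  and halves deviations, leaving \<open>11/20 * b\<close>; the slope term adds at most
  \<open>2/15 * b\<close>. The sum \<open>41/60 * b\<close> stays below \<open>7/10 * b\<close>
  after division by a coefficient of at least \<open>999/1000\<close>.\<close>

lemma inner_map_rhs: "\<bar>(1 - ratio_map b g k x) / 2 - 1/3 * (1 - \<beta> * slope g x)\<bar>
    \<le> 7/10 * b * (1 - \<beta> * slope g x)"
proof -
  have "b * (1 - 1/1000) \<le> b * (1 - \<beta> * slope g x)" 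
    using b beta_slope[of x] by (intro mult_left_mono) linarith+
  then show ?thesis using ratio_map_dev[of x] beta_slope(1)[of x] b
    unfolding diff_divide_distrib right_diff_distrib by linarith
qed

lemma inner_map_sol: "bsol_up (\<lambda>x. 1 - \<beta> * slope g x)
    (\<lambda>x. (1 - ratio_map b g k x) / 2) (\<lambda>x. \<beta> * speed g x) (inner_map b g k)"
  unfolding inner_map_def
proof (rule bsol_up_solve_up[OF dom_inner_map, of _ "1/3 + 7/10 * b"])
  show "continuous_on UNIV (\<lambda>x. (1 - ratio_map b g k x) / 2)"
    by (intro continuous_intros bsol_up_cont[OF ratio_map_sol]) auto
  show "\<bar>(1 - ratio_map b g k x) / 2\<bar> \<le> (1/3 + 7/10 * b) * (1 - \<beta> * slope g x)" for x
    unfolding distrib_right by (rule abs_le_addI[OF inner_map_rhs]) (use beta_slope(2)[of x] in simp)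
qed

lemma inner_map_dev: "\<bar>inner_map b g k x - 1/3\<bar> \<le> 7/10 * b"
  by (rule bsol_up_dev[OF dom_inner_map inner_map_sol inner_map_rhs])

lemma inner_map_near: "near b (inner_map b g k)"
  unfolding near_def
proof (intro conjI allI bsol_up_cont[OF inner_map_sol])
  show "\<bar>inner_map b g k x - 1/3\<bar> \<le> b" for x using inner_map_dev[of x] b by linarith
qed

lemma dom_outer_map: "dominates (flip (\<lambda>x. 1 + \<beta> * slope g x)) (flip
    (\<lambda>x. \<beta> * speed g x))"
  unfolding flip_def
  by (rule dominates_halfI)
    (use beta_slope beta_speed in \<open>auto
    intro!: continuous_intros continuous_on_compose2[OF cont(4)] continuous_on_compose2[OF cont(5)]\<close>)

text \<open>The margin between \<open>7/10 * b\<close> and \<open>b\<close> pays for the slope term,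
  so the ball of radius \<open>b\<close> is mapped into itself.\<close>

lemma outer_map_rhs: "\<bar>inner_map b g k x - 1/3 * (1 + \<beta> * slope g x)\<bar> \<le> b * (1
    + \<beta> * slope g x)"
proof -
  have "b * (1 - 1/1000) \<le> b * (1 + \<beta> * slope g x)" 
    using b beta_slope[of x] by (intro mult_left_mono) linarith+
  then show ?thesis using inner_map_dev[of x] beta_slope(1)[of x] b
    unfolding distrib_left right_diff_distrib by linarith
qed

lemma outer_map_sol: "bsol_down (\<lambda>x. 1 + \<beta> * slope g x) (inner_map b g k)
    (\<lambda>x. \<beta> * speed g x) (outer_map b g k)"
  unfolding outer_map_def
proof (rule bsol_down_solve_down[OF dom_outer_map, of _ "1/3 + b"])
  show "continuous_on UNIV (inner_map b g k)" by (rule bsol_up_cont[OF inner_map_sol]) 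
  show "\<bar>inner_map b g k x\<bar> \<le> (1/3 + b) * (1 + \<beta> * slope g x)" for x
    unfolding distrib_right[of "1/3"] by (rule abs_le_addI[OF outer_map_rhs]) (use beta_slope(3)[of x]
    in simp)
qed

lemma outer_map_near: "near b (outer_map b g k)"
  unfolding near_def
      using bsol_down_dev[OF dom_outer_map outer_map_sol outer_map_rhs] bsol_down_cont[OF outer_map_sol]
      by blast

end

section \<open>Lipschitz estimates for the fixed-point map\<close>

lemma ratio_map_rhs_diff:
  "l * (g1 * (a1 - t1)) - l * (g2 * (a2 - t2)) - (l * a1 - l * a2) * r
      + q * (l * a2 * r - l * (g2 * (a2 - t2))) =
   l * (a1 * (g1 - g2) + (a1 - a2) * (g2 - r) - (g1 - g2) * t1 - g2 * (t1 - t2) + q * (a2 * (r - g2)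
       + g2 * t2))"
  for l g1 g2 a1 a2 t1 t2 r q :: real
  by algebra

locale near_pair2 = p1: near_pair b g1 k1 + p2: near_pair b g2 k2 for b g1 k1 g2 k2 +
  fixes D assumes gD: "\<And>x. \<bar>g1 x - g2 x\<bar> \<le> D" and kD:
      "\<And>x. \<bar>k1 x - k2 x\<bar> \<le> D"
begin

lemma D: "0 \<le> D" "b * D \<le> D / 1000" "0 \<le> b * D" "b * (b * D) \<le> b * D / 1000"
proof -
  show 1: "0 \<le> D" using gD[of 0] by linarith
  then show 2: "b * D \<le> D / 1000" using mult_right_mono[OF p1.b(2) 1] by simp
  show "0 \<le> b * D" using 1 p1.b by simp
  show "b * (b * D) \<le> b * D / 1000" using mult_left_mono[OF 2, of b] p1.b by simp
qed

lemma AD: "\<bar>left_avg g1 x - left_avg g2 x\<bar> \<le> D"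
  by (rule left_avg_diff[OF near_bcont[OF p1.g] near_bcont[OF p2.g] gD])

lemmas QD = speed_diff[OF p1.g p2.g gD]
lemmas bD = layer_width_diff[OF p1.g p2.g gD p1.b(2,1)]

lemma Qratio: "\<bar>speed g1 x / speed g2 x - 1\<bar> \<le> 14 * D"
proof -
  note Q = speed_bounds[OF p2.g p2.b(2), of x]
  have "speed g1 x / speed g2 x - 1 = (speed g1 x - speed g2 x) / speed g2 x" using Q
      by (simp add: field_simps)
  then have "\<bar>speed g1 x / speed g2 x - 1\<bar> = \<bar>speed g1 x - speed g2 x\<bar> / speed g2 x"
      using Q by simp
  also have "\<dots> \<le> (2 * D) / (3/20)" using Q QD(1)[of x] by (intro frac_le) auto
  finally show ?thesis using D by simp
qed

text \<open>This relative change is of order \<open>D\<close> without a factor \<open>b\<close>; it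
  is harmless because in \<open>bsol_up_diff\<close> it multiplies a residual of order
  \<open>b\<close>.\<close>

lemma cratio: "\<bar>layer_width b g1 * speed g1 x / (layer_width b g2 * speed g2 x) - 1\<bar> \<le> 30 * D"
proof -
  have "layer_width b g1 / layer_width b g2 \<le> 2" "0 \<le> layer_width b g1 / layer_width b g2"
    using p1.beta p2.beta by (auto simp: field_simps)
  then have "\<bar>layer_width b g1 / layer_width b g2\<bar> \<le> 2" by linarith
  note 1 = abs_mult_mono[OF this Qratio[of x]]
  have "layer_width b g1 * speed g1 x / (layer_width b g2 * speed g2 x) - 1 =
    layer_width b g1 / layer_width b g2 * (speed g1 x / speed g2 x - 1)
    + (layer_width b g1 / layer_width b g2 - 1)"
    using p2.beta p2.bounds[of x] by (simp add: field_simps)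
  then show ?thesis by (rule ssubst) (rule order_trans[OF abs_add_mono[OF 1 bD(1)]], simp)
qed

lemma tD: "\<bar>defect b g1 k1 x - defect b g2 k2 x\<bar> \<le> b * D"
proof -
  \<comment> \<open>Telescoping: the three factors of the product are changed one at a time.\<close>
  let ?e = "(layer_width b g1 - layer_width b g2) * speed g1 x * (k1 x - g1 x)
     + layer_width b g2 * (speed g1 x - speed g2 x) * (k1 x - g1 x)
     + layer_width b g2 * speed g2 x * ((k1 x - k2 x) - (g1 x - g2 x))"
  have a: "\<bar>(layer_width b g1 - layer_width b g2) * speed g1 x * (k1 x - g1 x)\<bar>
      \<le> (4 * b * D) * (1/5) * (2 * b)"
    by (intro abs_mult_mono bD p1.bounds)
  have b: "\<bar>layer_width b g2 * (speed g1 x - speed g2 x) * (k1 x - g1 x)\<bar>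
      \<le> (2 * b) * (2 * D) * (2 * b)"
    by (intro abs_mult_mono QD p1.bounds p2.beta)
  have "\<bar>(k1 x - k2 x) - (g1 x - g2 x)\<bar> \<le> 2 * D" using gD[of x] kD[of x] by linarith
  then have c: "\<bar>layer_width b g2 * speed g2 x * ((k1 x - k2 x) - (g1 x - g2 x))\<bar>
      \<le> (2 * b) * (1/5) * (2 * D)"
    by (intro abs_mult_mono p2.bounds p2.beta)
  have "\<bar>?e\<bar> \<le> (4 * b * D) * (1/5) * (2 * b) + (2 * b) * (2 * D) * (2 * b)
      + (2 * b) * (1/5) * (2 * D)"
    by (intro abs_add_mono a b c)
  also have "\<dots> = 48/5 * (b * (b * D)) + 4/5 * (b * D)" by (simp add: algebra_simps)
  also have "\<dots> \<le> b * D" using D by linarith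
  finally have e: "\<bar>?e\<bar> \<le> b * D" .
  have "defect b g1 k1 x - defect b g2 k2 x = (1 - logistic x) * ?e"
    unfolding defect_def by (simp add: algebra_simps)
  moreover have "\<bar>(1 - logistic x) * ?e\<bar> \<le> 1 * (b * D)"
    by (rule abs_mult_mono[OF _ e]) (use logistic_pos[of x] logistic_less_1[of x] in auto)
  ultimately show ?thesis by simp
qed

text \<open>The constant 1 comes from \<open>left_avg g1 x * (g1 x - g2 x)\<close> alone. The other
  terms total at most \<open>18 * b * D\<close>, and dividing by
  \<open>left_avg g1 x \<ge> 3/10\<close> turns 18 into 60.\<close>

lemma ratio_map_diff: "\<bar>ratio_map b g1 k1 x - ratio_map b g2 k2 x\<bar> \<le> (1 + 60 * b) * D"
proof (rule bsol_up_diff[OF p1.dom_ratio_map p1.ratio_map_sol p2.ratio_map_sol])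
  show "speed g2 x / 2 \<noteq> 0" for x using p2.bounds[of x] by simp
  fix x
  let ?a1 = "left_avg g1 x" and ?a2 = "left_avg g2 x" and ?t1 = "defect b g1 k1 x" and ?t2 =
      "defect b g2 k2 x"
    and ?r = "ratio_map b g2 k2 x" and ?q = "speed g1 x / speed g2 x - 1"
  let ?E = "?a1 * (g1 x - g2 x) + (?a1 - ?a2) * (g2 x - ?r) - (g1 x - g2 x) * ?t1 - g2 x * (?t1 - ?t2)
     + ?q * (?a2 * (?r - g2 x) + g2 x * ?t2)"
  have q: "speed g1 x / 2 / (speed g2 x / 2) = speed g1 x / speed g2 x" by simp
  \<comment> \<open>In this grouping every term but the first carries, besides the difference of the
    data, a factor of order \<open>b\<close>: the deviation of the ratio from \<open>g2\<close>, a
    defect, or the bound \<open>tD\<close>.\<close>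
  have eq: "logistic x * (g1 x * (?a1 - ?t1)) - logistic x * (g2 x * (?a2 - ?t2)) - (logistic x * ?a1 -
      logistic x * ?a2) * ?r +
     (speed g1 x / 2 / (speed g2 x / 2) - 1) * (logistic x * ?a2 * ?r - logistic x * (g2 x * (?a2 -
     ?t2))) = logistic x * ?E"
    unfolding q by (rule ratio_map_rhs_diff)
  have r: "\<bar>g2 x - ?r\<bar> \<le> 21/10 * b" "\<bar>?r - g2 x\<bar> \<le> 21/10 * b"
      using p2.bounds(1)[of x] p2.ratio_map_dev[of x] by linarith+
  have 1: "\<bar>?a1 * (g1 x - g2 x)\<bar> \<le> ?a1 * D" using gD[of x] p1.bounds(7)[of x] by (auto
      simp: abs_mult intro!: mult_left_mono)
  have 2: "\<bar>(?a1 - ?a2) * (g2 x - ?r)\<bar> \<le> D * (21/10 * b)" by (intro abs_mult_mono AD r)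
  have 3: "\<bar>(g1 x - g2 x) * ?t1\<bar> \<le> D * (b / 1000)" by (intro abs_mult_mono gD p1.defect_bound)
  have 4: "\<bar>g2 x * (?t1 - ?t2)\<bar> \<le> 4/10 * (b * D)" by (intro abs_mult_mono p2.bounds tD)
  have "\<bar>?a2 * (?r - g2 x)\<bar> \<le> 4/10 * (21/10 * b)" "\<bar>g2 x * ?t2\<bar>
      \<le> 4/10 * (b / 1000)" 
    by (intro abs_mult_mono p2.bounds p2.defect_bound r)+
  then have "\<bar>?a2 * (?r - g2 x) + g2 x * ?t2\<bar> \<le> 85/100 * b" using p1.b by linarith
  then have 5: "\<bar>?q * (?a2 * (?r - g2 x) + g2 x * ?t2)\<bar> \<le> (14 * D) * (85/100 * b)"
      by (intro abs_mult_mono Qratio)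
  have "?a1 * D + D * (21/10 * b) + D * (b / 1000) + 4/10 * (b * D) + (14 * D) * (85/100 * b)
      \<le> ?a1 * D + 18 * (b * D)"
    using D(3) by (simp add: mult.commute[of D])
  also have "\<dots> \<le> ?a1 * D + 60 * (b * D) * ?a1" 
    using mult_left_mono[OF p1.bounds(7)[of x], of "60 * (b * D)"] D(3) by linarith
  also have "\<dots> = (1 + 60 * b) * D * ?a1" by (simp add: algebra_simps)
  finally have "\<bar>?E\<bar> \<le> (1 + 60 * b) * D * ?a1"
    by (rule order_trans[OF abs_add_mono[OF abs_diff_mono[OF abs_diff_mono[OF abs_add_mono[OF 1 2] 3] 4] 5]])
  then have "logistic x * \<bar>?E\<bar> \<le> logistic x * ((1 + 60 * b) * D * ?a1)"
      using logistic_pos[of x] by (intro mult_left_mono) auto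
  then show "\<bar>logistic x * (g1 x * (?a1 - ?t1)) - logistic x * (g2 x * (?a2 - ?t2)) - (logistic x *
      ?a1 - logistic x * ?a2) * ?r +
     (speed g1 x / 2 / (speed g2 x / 2) - 1) * (logistic x * ?a2 * ?r - logistic x * (g2 x * (?a2 -
     ?t2)))\<bar> \<le> (1 + 60 * b) * D * (logistic x * ?a1)"
    unfolding eq abs_mult abs_of_pos[OF logistic_pos] by (simp only: mult.left_commute)
qed

lemma bSD: "\<bar>layer_width b g1 * slope g1 x - layer_width b g2 * slope g2 x\<bar> \<le> 14/5 * (b * D)"
proof -
  have "\<bar>(layer_width b g1 - layer_width b g2) * slope g1 x\<bar> \<le> (4 * b * D) * (1/5)" 
    by (intro abs_mult_mono bD slope_bound[OF p1.g p1.b(2)])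
  moreover have "\<bar>layer_width b g2 * (slope g1 x - slope g2 x)\<bar> \<le> (2 * b) * D"
      by (intro abs_mult_mono p2.beta QD)
  moreover have "layer_width b g1 * slope g1 x - layer_width b g2 * slope g2 x
      = (layer_width b g1 - layer_width b g2) * slope g1 x + layer_width b g2 * (slope g1 x - slope g2 x)"
    by (simp add: algebra_simps)
  ultimately show ?thesis by linarith
qed

text \<open>The contraction arises here: the source \<open>(1 - r) / 2\<close> halves the distance
  of the ratios. The remainder, at most \<open>74 * b * D\<close>, is absorbed by raising
  \<open>1/2\<close> to \<open>3/5\<close>.\<close>

lemma inner_map_diff: "\<bar>inner_map b g1 k1 x - inner_map b g2 k2 x\<bar> \<le> 3/5 * D"
proof (rule bsol_up_diff[OF p1.dom_inner_map p1.inner_map_sol p2.inner_map_sol])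
  show "layer_width b g2 * speed g2 x \<noteq> 0" for x using p2.beta_speed(1)[of x] by linarith
  fix x
  let ?h1 = "(1 - ratio_map b g1 k1 x) / 2" and ?h2 = "(1 - ratio_map b g2 k2 x) / 2" and ?k =
      "inner_map b g2 k2 x"
   and ?s1 = "layer_width b g1 * slope g1 x" and ?s2 = "layer_width b g2 * slope g2 x" and ?q =
       "layer_width b g1 * speed g1 x / (layer_width b g2 * speed g2 x) - 1"
  have k4: "\<bar>?k\<bar> \<le> 4/10" using p2.inner_map_dev[of x] p2.b by linarith
  have 1: "\<bar>?h1 - ?h2\<bar> \<le> 1/2 * D + 30 * (b * D)"
    using ratio_map_diff[of x] unfolding diff_divide_distrib distrib_right by linarith
  have 2: "\<bar>(?s1 - ?s2) * ?k\<bar> \<le> 14/5 * (b * D) * (4/10)" by (intro abs_mult_mono bSD k4)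
  have "\<bar>?s2 * ?k\<bar> \<le> (2/5 * b) * (4/10)" by (intro abs_mult_mono p2.beta_slope k4)
  moreover have "(1 - ?s2) * ?k - ?h2 = ?k - ?h2 - ?s2 * ?k" by (simp add: algebra_simps)
  ultimately have "\<bar>(1 - ?s2) * ?k - ?h2\<bar> \<le> 141/100 * b" 
    using p2.inner_map_dev[of x] p2.ratio_map_dev[of x] unfolding diff_divide_distrib by linarith
  then have 3: "\<bar>?q * ((1 - ?s2) * ?k - ?h2)\<bar> \<le> (30 * D) * (141/100 * b)"
      by (intro abs_mult_mono cratio)
  have "?h1 - ?h2 - ((1 - ?s1) - (1 - ?s2)) * ?k + ?q * ((1 - ?s2) * ?k - ?h2) = 
    ?h1 - ?h2 + (?s1 - ?s2) * ?k + ?q * ((1 - ?s2) * ?k - ?h2)" by (simp add: algebra_simps)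
  then have "\<bar>?h1 - ?h2 - ((1 - ?s1) - (1 - ?s2)) * ?k + ?q * ((1 - ?s2) * ?k - ?h2)\<bar> \<le> 
    \<bar>?h1 - ?h2\<bar> + \<bar>(?s1 - ?s2) * ?k\<bar> + \<bar>?q * ((1 - ?s2) * ?k - ?h2)\<bar>"
      by (simp only:) (intro abs_add_mono abs_diff_mono order_refl)
  also have "\<dots> \<le> 1/2 * D + 74 * (b * D)" using 1 2 3 D(3) by (simp add: mult.commute[of D])
  also have "\<dots> \<le> 3/5 * D * (1 - 1/1000)" using D(1,2) by (simp add: mult.commute[of D])
  also have "\<dots> \<le> 3/5 * D * (1 - ?s1)" using D p1.beta_slope(1)[of x] p1.b
      by (intro mult_left_mono) linarith+
  finally show "\<bar>?h1 - ?h2 - ((1 - ?s1) - (1 - ?s2)) * ?k + ?q * ((1 - ?s2) * ?k - ?h2)\<bar>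
      \<le> 3/5 * D * (1 - ?s1)" .
qed

text \<open>Averaging preserves the factor \<open>3/5\<close> of the source; the changes of the
  coefficients add at most \<open>57 * b * D\<close>, which \<open>33/50\<close>
  accommodates.\<close>

lemma outer_map_diff: "\<bar>outer_map b g1 k1 x - outer_map b g2 k2 x\<bar> \<le> 33/50 * D"
proof (rule bsol_down_diff[OF p1.dom_outer_map p1.outer_map_sol p2.outer_map_sol])
  show "layer_width b g2 * speed g2 x \<noteq> 0" for x using p2.beta_speed(1)[of x] by linarith
  fix x
  let ?h1 = "inner_map b g1 k1 x" and ?h2 = "inner_map b g2 k2 x" and ?k = "outer_map b g2 k2 x"
   and ?s1 = "layer_width b g1 * slope g1 x" and ?s2 = "layer_width b g2 * slope g2 x" and ?q =
       "layer_width b g1 * speed g1 x / (layer_width b g2 * speed g2 x) - 1"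
  have k: "\<bar>?k - 1/3\<bar> \<le> b" using p2.outer_map_near by (auto simp: near_def)
  then have k4: "\<bar>?k\<bar> \<le> 4/10" using p2.b by linarith
  have 2: "\<bar>(?s1 - ?s2) * ?k\<bar> \<le> 14/5 * (b * D) * (4/10)" by (intro abs_mult_mono bSD k4)
  have "\<bar>?s2 * ?k\<bar> \<le> (2/5 * b) * (4/10)" by (intro abs_mult_mono p2.beta_slope k4)
  moreover have "(1 + ?s2) * ?k - ?h2 = ?k - ?h2 + ?s2 * ?k" by (simp add: algebra_simps)
  ultimately have "\<bar>(1 + ?s2) * ?k - ?h2\<bar> \<le> 186/100 * b" 
    using p2.inner_map_dev[of x] k by linarith
  then have 3: "\<bar>?q * ((1 + ?s2) * ?k - ?h2)\<bar> \<le> (30 * D) * (186/100 * b)"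
      by (intro abs_mult_mono cratio)
  have "?h1 - ?h2 - ((1 + ?s1) - (1 + ?s2)) * ?k + ?q * ((1 + ?s2) * ?k - ?h2) = 
    ?h1 - ?h2 - (?s1 - ?s2) * ?k + ?q * ((1 + ?s2) * ?k - ?h2)" by (simp add: algebra_simps)
  then have "\<bar>?h1 - ?h2 - ((1 + ?s1) - (1 + ?s2)) * ?k + ?q * ((1 + ?s2) * ?k - ?h2)\<bar> \<le> 
    \<bar>?h1 - ?h2\<bar> + \<bar>(?s1 - ?s2) * ?k\<bar> + \<bar>?q * ((1 + ?s2) * ?k - ?h2)\<bar>"
      by (simp only:) (intro abs_add_mono abs_diff_mono order_refl)
  also have "\<dots> \<le> 3/5 * D + 57 * (b * D)" using inner_map_diff[of x] 2 3 D(3)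
      by (simp add: mult.commute[of D])
  also have "\<dots> \<le> 33/50 * D * (1 - 1/1000)" using D(1,2) by (simp add: mult.commute[of D])
  also have "\<dots> \<le> 33/50 * D * (1 + ?s1)" using D p1.beta_slope(1)[of x] p1.b
      by (intro mult_left_mono) linarith+
  finally show "\<bar>?h1 - ?h2 - ((1 + ?s1) - (1 + ?s2)) * ?k + ?q * ((1 + ?s2) * ?k - ?h2)\<bar>
      \<le> 33/50 * D * (1 + ?s1)" .
qed

end

section \<open>Banach's fixed-point theorem in a ball of bounded continuous functions\<close>

lemma near_bcontfun: "near b g \<Longrightarrow> g \<in> bcontfun"
  using near_bcont[of b g] by (simp add: bcont_def bcontfun_def)

lemma near_cball:
  "near b (apply_bcontfun f) \<longleftrightarrow> f \<in> cball (const_bcontfun (1/3)) b" for f ::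
      "real \<Rightarrow>\<^sub>C real"
proof
  assume "near b f"
  then have "dist (apply_bcontfun (const_bcontfun (1/3)) x) (f x) \<le> b" for x
    by (auto simp: near_def dist_real_def const_bcontfun.rep_eq abs_minus_commute)
  then show "f \<in> cball (const_bcontfun (1/3)) b" by (simp add: dist_bound)
next
  assume "f \<in> cball (const_bcontfun (1/3)) b"
  then have "dist (apply_bcontfun (const_bcontfun (1/3)) x) (f x) \<le> b" for x
    by (intro order_trans[OF dist_bounded]) auto
  then show "near b f"
    by (auto simp: near_def dist_real_def const_bcontfun.rep_eq abs_minus_commute)
qed

lemma fixed_point:
  assumes b: "0 < b" "b \<le> 1/1000"
  obtains g k where "near b g" "near b k" "outer_map b g k = g" "inner_map b g k = k"
proof -
  define B where "B = cball (const_bcontfun (1/3) :: real \<Rightarrow>\<^sub>C real) b"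
  define T where "T =
      (\<lambda>(g::real \<Rightarrow>\<^sub>C real, k::real \<Rightarrow>\<^sub>C real). (Bcontfun
      (outer_map b g k), Bcontfun (inner_map b g k)))"
  have np: "near_pair b g k" if "(g, k) \<in> B \<times> B" for g k :: "real \<Rightarrow>\<^sub>C real"
    using that b by (auto simp: near_pair_def B_def near_cball)
  \<comment> \<open>\<open>Bcontfun\<close> is meaningful only on bounded continuous functions;
    invariance of the ball guarantees that the images are such.\<close>
  have inv: "apply_bcontfun (Bcontfun (outer_map b g k)) = outer_map b g k"
      "apply_bcontfun (Bcontfun (inner_map b g k)) = inner_map b g k"
    if "(g, k) \<in> B \<times> B" for g k :: "real \<Rightarrow>\<^sub>C real"
    using near_pair.outer_map_near[OF np[OF that]] near_pair.inner_map_near[OF np[OF that]]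
    by (auto intro!: Bcontfun_inverse near_bcontfun)
  have "\<exists>!x\<in>B \<times> B. T x = x"
  proof (rule Banach_fix)
    show "complete (B \<times> B)" unfolding B_def
        by (intro complete_closed_subset[OF _ subset_UNIV complete_UNIV] closed_Times) auto
    show "B \<times> B \<noteq> {}" using b by (auto simp: B_def)
    show "0 \<le> (9/10::real)" "(9/10::real) < 1" by auto
    show "T ` (B \<times> B) \<subseteq> B \<times> B"
    proof safe
      fix g k u v assume gk: "g \<in> B" "k \<in> B" and "(u, v) = T (g, k)"
      then have uv: "apply_bcontfun u = outer_map b g k" "apply_bcontfun v = inner_map b g k"
        using inv by (auto simp: T_def)
      have "near b u" "near b v" unfolding uv
        using near_pair.outer_map_near[OF np] near_pair.inner_map_near[OF np] gk by auto
      then show "u \<in> B" "v \<in> B" by (auto simp: B_def near_cball)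
    qed
    show "dist (T x) (T y) \<le> 9/10 * dist x y" if "x \<in> B \<times> B" "y \<in> B \<times> B" for x y
    proof -
      obtain g1 k1 g2 k2 where xy: "x = (g1, k1)" "y = (g2, k2)" by fastforce
      define D where "D = dist x y"
      have "dist g1 g2 \<le> D" "dist k1 k2 \<le> D" unfolding D_def xy dist_Pair_Pair by auto
      then have "dist (g1 t) (g2 t) \<le> D" "dist (k1 t) (k2 t) \<le> D" for t
        using order_trans[OF dist_bounded] by blast+
      then interpret near_pair2 b g1 k1 g2 k2 D
        using np that unfolding xy near_pair2_def near_pair2_axioms_def by (auto simp: dist_real_def)
      have 1: "dist (Bcontfun (outer_map b g1 k1)) (Bcontfun (outer_map b g2 k2)) \<le> 33/50 * D"
        using that outer_map_diff by (intro dist_bound) (auto simp: inv xy dist_real_def)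
      have 2: "dist (Bcontfun (inner_map b g1 k1)) (Bcontfun (inner_map b g2 k2)) \<le> 3/5 * D"
        using that inner_map_diff by (intro dist_bound) (auto simp: inv xy dist_real_def)
      \<comment> \<open>The product carries the Euclidean metric, and
        \<open>(33/50)\<^sup>2 + (3/5)\<^sup>2 < (9/10)\<^sup>2\<close>.\<close>
      have "dist (T x) (T y) \<le> sqrt ((33/50 * D)\<^sup>2 + (3/5 * D)\<^sup>2)"
        unfolding xy T_def dist_Pair_Pair prod.case using 1 2
        by (intro real_sqrt_le_mono add_mono power_mono) auto
      also have "\<dots> \<le> sqrt ((9/10 * D)\<^sup>2)"
        by (intro real_sqrt_le_mono) (simp add: power2_eq_square)
      also have "\<dots> = 9/10 * D" using D by simp
      finally show ?thesis unfolding D_def .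
    qed
  qed
  then obtain g k where "(g, k) \<in> B \<times> B" "T (g, k) = (g, k)" by (metis surj_pair)
  then have "(g, k) \<in> B \<times> B" "Bcontfun (outer_map b g k) = g" "Bcontfun (inner_map b g k) = k"
    by (simp_all add: T_def)
  then have "near b g" "near b k" "outer_map b g k = g" "inner_map b g k = k"
    using inv[of g k] by (auto simp: B_def near_cball)
  then show ?thesis by (rule that)
qed

subsection \<open>Profiles and their reflection\<close>

text \<open>Changing the sign of \<open>q\<close> switches the branch of the exchange term and the
  sign of \<open>uT\<close>; the latter cancels against the sign in the swapped concentrations. At
  \<open>q = 0\<close> both branches vanish.\<close>

lemma exch_swap: "exch l (- c2) (- c1) (- q) = exch l c1 c2 q"
  by (auto simp: exch_def Let_def divide_le_0_iff zero_le_divide_iff)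

text \<open>The equations in the moving frame with the second velocity eliminated as
  \<open>- u\<close> and \<open>u' = q / l\<^sup>2\<close> inserted; \<open>p1\<close>,
  \<open>p2\<close> are the first and \<open>s1\<close>, \<open>s2\<close> the second derivatives of
  the concentrations.\<close>

definition wave_profile ::
  "real \<Rightarrow> (real \<Rightarrow> real) \<Rightarrow> (real \<Rightarrow> real) \<Rightarrow>
      (real \<Rightarrow> real) \<Rightarrow> (real \<Rightarrow> real) \<Rightarrow> real \<Rightarrow>
      bool" where
  "wave_profile l c1 c2 u q v \<longleftrightarrow> (\<exists>p1 p2 s1 s2. \<forall>x.
     (c1 has_real_derivative p1 x) (at x) \<and> (p1 has_real_derivative s1 x) (at x) \<and>
     (c2 has_real_derivative p2 x) (at x) \<and> (p2 has_real_derivative s2 x) (at x) \<and>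
     (u has_real_derivative q x / l\<^sup>2) (at x) \<and>
     (q has_real_derivative 2 * u x + c1 x - c2 x) (at x) \<and>
     - v * p1 x + (u x * p1 x + q x / l\<^sup>2 * c1 x) - s1 x = - exch l (c1 x) (c2 x) (q x) \<and>
     - v * p2 x - (u x * p2 x + q x / l\<^sup>2 * c2 x) - s2 x = exch l (c1 x) (c2 x) (q x))"

lemma wave_profile_solution:
  assumes "wave_profile l c1 c2 u q v"
  shows "ipm_solution l
      (\<lambda>t y. (c1 (y - v * t), c2 (y - v * t), u (y - v * t), - u (y - v * t), q (y - v * t)))"
proof -
  from assms obtain p1 p2 s1 s2 where
    c1: "\<And>x. (c1 has_real_derivative p1 x) (at x)" and p1:
    "\<And>x. (p1 has_real_derivative s1 x) (at x)" and
    c2: "\<And>x. (c2 has_real_derivative p2 x) (at x)" and p2: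
    "\<And>x. (p2 has_real_derivative s2 x) (at x)" and
    u: "\<And>x. (u has_real_derivative q x / l\<^sup>2) (at x)" and
    q: "\<And>x. (q has_real_derivative 2 * u x + c1 x - c2 x) (at x)" and
    e1: "\<And>x. - v * p1 x + (u x * p1 x + q x / l\<^sup>2 * c1 x) - s1 x
    = - exch l (c1 x) (c2 x) (q x)" and
    e2: "\<And>x. - v * p2 x - (u x * p2 x + q x / l\<^sup>2 * c2 x) - s2 x = exch l (c1 x) (c2 x) (q x)"
    unfolding wave_profile_def by blast
  have T: "dt_eq (\<lambda>t y. f (y - v * t)) t y (- v * f' (y - v * t))"
    if "\<And>x. (f has_real_derivative f' x) (at x)" for f f' t y
    unfolding dt_eq_def
    by (rule DERIV_cong, rule DERIV_chain2[where f = f and g = "\<lambda>s. y - v * s", OF that])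
      (auto intro!: derivative_eq_intros)
  have Y: "((\<lambda>z. f (z - v * t)) has_real_derivative f' (y - v * t)) (at y)"
    if "\<And>x. (f has_real_derivative f' x) (at x)" for f f' t y
    by (rule DERIV_cong, rule DERIV_chain2[where f = f and g = "\<lambda>z. z - v * t", OF that])
      (auto intro!: derivative_eq_intros)
  \<comment> \<open>This local fact concerns second space derivatives of a translated profile; it
    shares only its name with the functional \<open>right_moment\<close>.\<close>
  have right_moment: "dyy_eq (\<lambda>t y. f (y - v * t)) t y (f'' (y - v * t))"
    if f: "\<And>x. (f has_real_derivative f' x) (at x)" "\<And>x. (f' has_real_derivative f'' x) (at x)"
    for f f' f'' t y
  proof -
    have "deriv (\<lambda>x. f (x - v * t)) = (\<lambda>x. f' (x - v * t))"
      by (intro ext DERIV_imp_deriv Y f)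
    moreover have "(\<lambda>x. f (x - v * t)) differentiable (at z)" for z
      by (rule differentiableI[OF has_field_derivative_imp_has_derivative[OF Y[of f f', OF f(1)]]])
    moreover have "((\<lambda>x. f' (x - v * t)) has_real_derivative f'' (y - v * t)) (at y)"
      by (rule Y[of f' f'', OF f(2)])
    ultimately show ?thesis
      unfolding dyy_eq_def by (simp only: simp_thms)
  qed
  show ?thesis
    unfolding ipm_solution_def Let_def fst_conv snd_conv
  proof (intro allI impI conjI)
    fix t y :: real
    let ?x = "y - v * t"
    have 1: "dy_eq (\<lambda>t y. u (y - v * t) * c1 (y - v * t)) t y (u ?x * p1 ?x
        + q ?x / l\<^sup>2 * c1 ?x)"
      unfolding dy_eq_def
      by (rule DERIV_cong[OF DERIV_mult[OF Y[of u "\<lambda>x. q x / l\<^sup>2", OF u] Y[of c1 p1,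
      OF c1]]]) (simp add: algebra_simps)
    have 2: "dy_eq (\<lambda>t y. - u (y - v * t) * c2 (y - v * t)) t y (- (u ?x * p2 ?x
        + q ?x / l\<^sup>2 * c2 ?x))"
      unfolding dy_eq_def
      by (rule DERIV_cong[OF DERIV_mult[OF DERIV_minus[OF Y[of u "\<lambda>x. q x / l\<^sup>2",
      OF u]] Y[of c2 p2, OF c2]]]) (simp add: algebra_simps)
    have e2': "- v * p2 ?x + - (u ?x * p2 ?x + q ?x / l\<^sup>2 * c2 ?x) - s2 ?x
        = exch l (c1 ?x) (c2 ?x) (q ?x)"
      using e2[of ?x] by simp
    show "\<exists>a b e. dt_eq (\<lambda>t y. c1 (y - v * t)) t y a \<and>
         dy_eq (\<lambda>t y. u (y - v * t) * c1 (y - v * t)) t y b \<and>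
         dyy_eq (\<lambda>t y. c1 (y - v * t)) t y e \<and> a + b - e = - exch l (c1 ?x) (c2 ?x) (q ?x)"
      by (rule exI conjI T[OF c1] 1 right_moment[OF c1 p1] e1)+
    show "\<exists>a b e. dt_eq (\<lambda>t y. c2 (y - v * t)) t y a \<and>
         dy_eq (\<lambda>t y. - u (y - v * t) * c2 (y - v * t)) t y b \<and>
         dyy_eq (\<lambda>t y. c2 (y - v * t)) t y e \<and> a + b - e = exch l (c1 ?x) (c2 ?x) (q ?x)"
      by (rule exI conjI T[OF c2] 2 right_moment[OF c2 p2] e2')+
    show "dy_eq (\<lambda>t y. q (y - v * t)) t y (u ?x - - u ?x + c1 ?x - c2 ?x)"
      unfolding dy_eq_def by (rule DERIV_cong[OF Y[OF q]]) simp
    show "dy_eq (\<lambda>t y. u (y - v * t)) t y (q ?x / l\<^sup>2)"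
      unfolding dy_eq_def by (rule Y[OF u])
  qed simp
qed

lemma wave_profile_cont:
  assumes "wave_profile l c1 c2 u q v"
  shows "continuous_on UNIV c1" "continuous_on UNIV c2" "continuous_on UNIV u" "continuous_on UNIV q"
  using assms unfolding wave_profile_def
  by (blast intro: continuous_at_imp_continuous_on DERIV_isCont)+

lemma wave_profile_traveling:
  assumes w: "wave_profile l c1 c2 u q v"
    and "(c1 \<longlongrightarrow> a1) at_bot" "(c2 \<longlongrightarrow> a2) at_bot"
    "(u \<longlongrightarrow> a3) at_bot" "(q \<longlongrightarrow> 0) at_bot"
    and "(c1 \<longlongrightarrow> b1) at_top" "(c2 \<longlongrightarrow> b2) at_top"
    "(u \<longlongrightarrow> b3) at_top" "(q \<longlongrightarrow> 0) at_top"
  shows "traveling_wave l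
      (\<lambda>x. (c1 x, c2 x, u x, - u x, q x)) v (a1, a2, a3, - a3, 0) (b1, b2, b3, - b3, 0)"
  unfolding traveling_wave_def
  using wave_profile_solution[OF w] wave_profile_cont[OF w] assms
  by (auto intro!: continuous_intros tendsto_intros)

text \<open>Reversing \<open>x\<close> changes the sign of odd derivatives, and the sign changes of
  the concentrations, \<open>q\<close> and \<open>v\<close> compensate. The tubes trade places, so
  each concentration equation follows from the other one.\<close>

lemma wave_profile_reflect:
  assumes "wave_profile l c1 c2 u q v"
  shows "wave_profile l (\<lambda>x. - c2 (- x)) (\<lambda>x. - c1 (- x)) (\<lambda>x. u (- x))
      (\<lambda>x. - q (- x)) (- v)"
proof -
  from assms obtain p1 p2 s1 s2 where
    c1: "\<And>x. (c1 has_real_derivative p1 x) (at x)" and p1: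
    "\<And>x. (p1 has_real_derivative s1 x) (at x)" and
    c2: "\<And>x. (c2 has_real_derivative p2 x) (at x)" and p2:
    "\<And>x. (p2 has_real_derivative s2 x) (at x)" and
    u: "\<And>x. (u has_real_derivative q x / l\<^sup>2) (at x)" and
    q: "\<And>x. (q has_real_derivative 2 * u x + c1 x - c2 x) (at x)" and
    e1: "\<And>x. - v * p1 x + (u x * p1 x + q x / l\<^sup>2 * c1 x) - s1 x
    = - exch l (c1 x) (c2 x) (q x)" and
    e2: "\<And>x. - v * p2 x - (u x * p2 x + q x / l\<^sup>2 * c2 x) - s2 x = exch l (c1 x) (c2 x) (q x)"
    unfolding wave_profile_def by blast
  have R: "((\<lambda>x. f (- x)) has_real_derivative - f' (- x)) (at x)"
    if "\<And>x. (f has_real_derivative f' x) (at x)" for f f' :: "real \<Rightarrow> real" and x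
    by (rule DERIV_cong, rule DERIV_chain2[where f = f and g = uminus, OF that])
      (auto intro!: derivative_eq_intros)
  note RM = DERIV_cong[OF DERIV_minus[OF R]]
  show ?thesis
    unfolding wave_profile_def
  proof (intro exI allI conjI)
    fix x
    show "((\<lambda>x. - c2 (- x)) has_real_derivative p2 (- x)) (at x)" by (rule RM[OF c2]) simp
    show "((\<lambda>x. p2 (- x)) has_real_derivative - s2 (- x)) (at x)" by (rule R[OF p2])
    show "((\<lambda>x. - c1 (- x)) has_real_derivative p1 (- x)) (at x)" by (rule RM[OF c1]) simp
    show "((\<lambda>x. p1 (- x)) has_real_derivative - s1 (- x)) (at x)" by (rule R[OF p1])
    show "((\<lambda>x. u (- x)) has_real_derivative - q (- x) / l\<^sup>2) (at x)"
        by (rule DERIV_cong[OF R[OF u]]) simp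
    show "((\<lambda>x. - q (- x)) has_real_derivative 2 * u (- x) + - c2 (- x) - - c1 (- x)) (at x)"
      by (rule RM[OF q]) simp
    show "- (- v) * p2 (- x) + (u (- x) * p2 (- x) + - q (- x) / l\<^sup>2 * - c2 (- x)) - - s2 (- x) =
         - exch l (- c2 (- x)) (- c1 (- x)) (- q (- x))"
      unfolding exch_swap using e2[of "-x"] by (simp add: algebra_simps)
    show "- (- v) * p1 (- x) - (u (- x) * p1 (- x) + - q (- x) / l\<^sup>2 * - c1 (- x)) - - s1 (- x) =
         exch l (- c2 (- x)) (- c1 (- x)) (- q (- x))"
      unfolding exch_swap using e1[of "-x"] by (simp add: algebra_simps)
  qed
qed

lemma stationary_const:
  assumes "2 * u + c1 - c2 = 0"
  shows "stationary l (c1, c2, u, - u, 0)"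
proof -
  have "wave_profile l (\<lambda>_. c1) (\<lambda>_. c2) (\<lambda>_. u) (\<lambda>_. 0) 0"
    unfolding wave_profile_def using assms
    by (intro exI[of _ "\<lambda>_. 0"]) (simp add: exch_def)
  from wave_profile_solution[OF this] show ?thesis by (simp add: stationary_def)
qed

text \<open>The limit \<open>(a, - a, - a, a, 0)\<close> is invariant under the reflection, so the
  reflected wave starts where the first one ends; \<open>v \<le> 0\<close> puts the speeds
  \<open>v\<close>, \<open>- v\<close> in order.\<close>

lemma terrace_of_profile:
  assumes w: "wave_profile l c1 c2 u q v" and v: "v \<le> 0"
    and bot: "(c1 \<longlongrightarrow> -1) at_bot" "(c2 \<longlongrightarrow> -1) at_bot"
    "(u \<longlongrightarrow> 0) at_bot" "(q \<longlongrightarrow> 0) at_bot"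
    and top: "(c1 \<longlongrightarrow> a) at_top" "(c2 \<longlongrightarrow> - a) at_top"
    "(u \<longlongrightarrow> - a) at_top" "(q \<longlongrightarrow> 0) at_top"
  shows "\<exists>g1 g2. propagating_terrace l (-1, -1, 0, 0, 0) (1, 1, 0, 0, 0)
     [(-1, -1, 0, 0, 0), (a, - a, - a, a, 0), (1, 1, 0, 0, 0)] [g1, g2] [v, - v]"
proof -
  let ?g1 = "\<lambda>x. (c1 x, c2 x, u x, - u x, q x)"
  let ?g2 = "\<lambda>x. (- c2 (- x), - c1 (- x), u (- x), - u (- x), - q (- x))"
  have t1: "traveling_wave l ?g1 v (-1, -1, 0, 0, 0) (a, - a, - a, a, 0)"
    using wave_profile_traveling[OF w bot top] by simp
  have fl: "((\<lambda>x. f (- x)) \<longlongrightarrow> m) at_bot" if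
      "(f \<longlongrightarrow> m) at_top" for f :: "real \<Rightarrow> real" and m
    by (rule filterlim_compose[OF that filterlim_uminus_at_top_at_bot])
  have fr: "((\<lambda>x. f (- x)) \<longlongrightarrow> m) at_top" if
      "(f \<longlongrightarrow> m) at_bot" for f :: "real \<Rightarrow> real" and m
    by (rule filterlim_compose[OF that filterlim_uminus_at_bot_at_top])
  have t2: "traveling_wave l ?g2 (- v) (a, - a, - a, a, 0) (1, 1, 0, 0, 0)"
    using wave_profile_traveling[OF wave_profile_reflect[OF w], of a "- a" "- a" 1 1 0]
      tendsto_minus[OF fl[OF top(1)]] tendsto_minus[OF fl[OF top(2)]] fl[OF top(3)] tendsto_minus[OF
      fl[OF top(4)]]
      tendsto_minus[OF fr[OF bot(1)]] tendsto_minus[OF fr[OF bot(2)]] fr[OF bot(3)] tendsto_minus[OF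
      fr[OF bot(4)]]
    by simp
  have s: "stationary l (-1, -1, 0, 0, 0)" "stationary l (a, - a, - a, a, 0)" "stationary l (1, 1, 0, 0, 0)"
    using stationary_const[of 0 "-1" "-1" l] stationary_const[of "-a" a
    "-a" l] stationary_const[of 0 1 1 l] by auto
  have "propagating_terrace l (-1, -1, 0, 0, 0) (1, 1, 0, 0, 0)
     [(-1, -1, 0, 0, 0), (a, - a, - a, a, 0), (1, 1, 0, 0, 0)] [?g1, ?g2] [v, - v]"
    unfolding propagating_terrace_def using t1 t2 s v by (auto simp: less_Suc_eq numeral_eq_Suc)
  then show ?thesis by blast
qed

section \<open>Global solution of a scalar autonomous equation\<close>

lemma autonomous_flow:
  fixes Q :: "real \<Rightarrow> real"
  assumes Q: "continuous_on UNIV Q" and pos: "\<And>x. 0 < Q x" and le: "\<And>x. Q x \<le> M"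
  obtains \<Theta> where "\<And>x. (\<Theta> has_real_derivative Q (\<Theta> x)) (at x)"
    "filterlim \<Theta> at_top at_top" "filterlim \<Theta> at_bot at_bot"
proof -
  have M: "0 < M" using pos[of 0] le[of 0] by linarith
  have "continuous_on UNIV (\<lambda>x. 1 / Q x)"
    using pos by (intro continuous_intros Q) (simp add: less_imp_neq[symmetric])
  then obtain X where X: "\<And>x. (X has_real_derivative 1 / Q x) (at x)"
    using antiderivative_UNIV by blast
  \<comment> \<open>Separation of variables: the solution is the inverse of \<open>X\<close>. As
    \<open>Q \<le> M\<close>, \<open>X\<close> increases at rate at least \<open>1 / M\<close>,
    hence maps onto the whole line, and its inverse is defined for all times.\<close>
  have inc: "X x - x / M \<le> X y - y / M" if "x \<le> y" for x y
  proof (rule DERIV_nonneg_imp_nondecreasing[OF that])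
    fix t
    have "((\<lambda>x. X x - x / M) has_real_derivative 1 / Q t - 1 / M) (at t)"
      by (rule derivative_eq_intros X refl)+ (use M in auto)
    moreover have "0 \<le> 1 / Q t - 1 / M" using pos[of t] le[of t] by (simp add: frac_le)
    ultimately show "\<exists>y. ((\<lambda>x. X x - x / M) has_real_derivative y) (at t) \<and> 0
        \<le> y" by blast
  qed
  have smono: "X x < X y" if "x < y" for x y
    using inc[of x y] that M divide_strict_right_mono[OF that M] by linarith
  have mono: "X x \<le> X y \<longleftrightarrow> x \<le> y" for x y
    using smono[of x y] smono[of y x] by (cases x y rule: linorder_cases) auto
  have cont: "isCont X x" for x by (rule DERIV_isCont[OF X])
  have "\<exists>x. X x = s" for s
  proof -
    define h where "h = M * \<bar>s - X 0\<bar>"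
    have h: "0 \<le> h" "h / M = \<bar>s - X 0\<bar>" using M by (auto simp: h_def)
    have "s \<le> X h" using inc[of 0 h] h by simp
    moreover have "X (- h) \<le> s" using inc[of "- h" 0] h by simp
    ultimately show ?thesis using IVT[of X "- h" s h] cont h by auto
  qed
  then obtain \<Theta> where \<Theta>: "\<And>s. X (\<Theta> s) = s" by metis
  have inv: "\<Theta> (X x) = x" for x using mono[of x "\<Theta> (X x)"] mono[of
      "\<Theta> (X x)" x] \<Theta> by (simp add: antisym)
  have isC: "isCont \<Theta> s" for s
    using isCont_inverse_function[of 1 "\<Theta> s" \<Theta> X] inv cont \<Theta> by simp
  have "(\<Theta> has_real_derivative inverse (1 / Q (\<Theta> s))) (at s)" for s
    by (rule DERIV_inverse_function[where f = X and a = "s - 1" and b = "s + 1"])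
      (use X \<Theta> isC pos[of "\<Theta> s"] in auto)
  then have "(\<Theta> has_real_derivative Q (\<Theta> s)) (at s)" for s by simp
  moreover have "filterlim \<Theta> at_top at_top"
    unfolding filterlim_at_top eventually_at_top_linorder
    using mono \<Theta> by metis
  moreover have "filterlim \<Theta> at_bot at_bot"
    unfolding filterlim_at_bot eventually_at_bot_linorder
    using mono \<Theta> by metis
  ultimately show ?thesis by (rule that)
qed

subsection \<open>The wave of a fixed point\<close>

locale fixed_pair = near_pair +
  assumes Gfix: "outer_map b g k = g" and Kfix: "inner_map b g k = k"
begin

abbreviation "r \<equiv> ratio_map b g k"

definition P where "P x = logistic x * (1 - logistic x) * speed g x"
definition G where "G x = logistic x * left_avg g x"
text \<open>The constant value of \<open>slope g x + G x\<close>, read off at \<open>x = 0\<close>;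
  multiplied by the jump of \<open>c1\<close> it is minus the speed of the wave.\<close>

definition \<kappa> where "\<kappa> = slope g 0 + G 0"
definition gap where "gap x = 2 * G x - 2 * \<beta> * P x * (k x - g x)"

lemma Q_nz: "speed g x \<noteq> 0" and beta_nz: "\<beta> \<noteq> 0"
  using bounds(10)[of x] beta(1) by auto

lemma left_moment_deriv:
    "(left_moment g has_real_derivative (1 - logistic x) * (logistic x * g x - left_moment g x)) (at x)"
  unfolding left_moment_def by (rule left_avg_deriv[OF bcont_logistic_mult(1)[OF near_bcont[OF g]]])

lemma right_moment_deriv:
    "(right_moment g has_real_derivative logistic x * (right_moment g x - (1 - logistic x) * g x)) (at x)"
  unfolding right_moment_def by (rule right_avg_deriv[OF bcont_logistic_mult(2)[OF near_bcont[OF g]]])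

lemma P_deriv: "(P has_real_derivative logistic x * (1 - logistic x) * slope g x) (at x)"
  unfolding P_def[abs_def] speed_def slope_def
  by (rule derivative_eq_intros left_moment_deriv right_moment_deriv refl)+ algebra

lemma S_deriv: "(slope g has_real_derivative - (logistic x * (1 - logistic x) * g x)) (at x)"
  unfolding slope_def[abs_def]
  by (rule derivative_eq_intros left_moment_deriv right_moment_deriv refl)+ algebra

lemma G_deriv: "(G has_real_derivative logistic x * (1 - logistic x) * g x) (at x)"
  unfolding G_def[abs_def]
  by (rule derivative_eq_intros left_avg_deriv[OF near_bcont[OF g]] refl)+ algebra

text \<open>In the coordinate \<open>z\<close> the derivatives of \<open>slope g\<close> and
  \<open>G\<close> are \<open>- g\<close> and \<open>g\<close>. The identity is the equation for
  \<open>c1\<close> in integrated form: up to scaling it says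
  \<open>c1'' / c1' = u - v\<close>.\<close>

lemma S_eq: "slope g x = \<kappa> - G x"
proof -
  have "((\<lambda>x. slope g x + G x) has_real_derivative 0) (at x)" for x
    using DERIV_add[OF S_deriv G_deriv, of x] by simp
  from DERIV_isconst_all[OF allI, OF this, of x 0] show ?thesis by (simp add: \<kappa>_def)
qed

lemma g_deriv: "(g has_real_derivative (k x - (1
    + \<beta> * slope g x) * g x) / (\<beta> * speed g x)) (at x)"
  using bsol_down_deriv[OF outer_map_sol, of x] by (simp add: Gfix Kfix)

lemma k_deriv:
    "(k has_real_derivative ((1 - \<beta> * slope g x) * k x - (1 - r x) / 2) / (\<beta> * speed g x)) (at x)"
  using bsol_up_deriv[OF inner_map_sol, of x] by (simp add: Kfix)

lemma r_deriv: "(r has_real_derivative (2 * G x * r x - g x * gap x) / speed g x) (at x)"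
proof (rule DERIV_cong[OF bsol_up_deriv[OF ratio_map_sol]])
  \<comment> \<open>\<open>logistic x * defect b g k x\<close> is
    \<open>\<beta> * P x * (k x - g x)\<close>; in the averaging equation one factor
    \<open>logistic\<close> was taken out of the gap.\<close>
  have "logistic x * (g x * (left_avg g x - defect b g k x)) = g x * gap x / 2"
    by (simp add: gap_def defect_def G_def P_def algebra_simps)
  then show "(logistic x * left_avg g x * r x - logistic x * (g x * (left_avg g x - defect b g k x))) /
      (speed g x / 2) = 
     (2 * G x * r x - g x * gap x) / speed g x"
    using Q_nz[of x] by (simp add: G_def field_simps)
qed

text \<open>In the derivative of \<open>\<beta> * P * (k - g)\<close> the equations for
  \<open>g\<close> and \<open>k\<close> make all slope terms cancel. What remains identifies
  \<open>r\<close>, so far only the solution of an averaging equation, with the ratio of the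
  derivatives of \<open>c2\<close> and \<open>c1\<close>.\<close>

lemma gap_deriv: "(gap has_real_derivative logistic x * (1 - logistic x) * (1 - r x)) (at x)"
proof -
  let ?g' = "(k x - (1 + \<beta> * slope g x) * g x) / (\<beta> * speed g x)"
  let ?k' = "((1 - \<beta> * slope g x) * k x - (1 - r x) / 2) / (\<beta> * speed g x)"
  let ?w = "logistic x * (1 - logistic x)"
  have "(gap has_real_derivative 2 * (?w * g x) - (2 * \<beta> * (?w * slope g x) * (k x - g x)
      + 2 * \<beta> * P x * (?k' - ?g'))) (at x)"
    unfolding gap_def[abs_def]
    by (rule derivative_eq_intros G_deriv P_deriv g_deriv k_deriv refl)+ (simp add: algebra_simps)
  moreover have "2 * (?w * g x) - (2 * \<beta> * (?w * slope g x) * (k x - g x)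
      + 2 * \<beta> * P x * (?k' - ?g')) = ?w * (1 - r x)"
  proof -
    define e where "e = (1 - r x) / 2"
    have e: "1 - r x = 2 * e" by (simp add: e_def)
    have "\<beta> * speed g x * ?k' = (1 - \<beta> * slope g x) * k x - e" "\<beta> * speed g x * ?g'
        = k x - (1 + \<beta> * slope g x) * g x"
      using Q_nz[of x] beta_nz by (simp_all add: e_def)
    then show ?thesis unfolding P_def e by algebra
  qed
  ultimately show ?thesis by simp
qed

lemma P_lims: "(P \<longlongrightarrow> 0) at_bot" "(P \<longlongrightarrow> 0) at_top"
proof -
  have Bf: "Bfun (speed g) F" for F :: "real filter"
    using bounds(11) by (intro BfunI[of _ "1/5"]) auto
  have w: "((\<lambda>x. logistic x * (1 - logistic x)) \<longlongrightarrow> 0) at_bot"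
      "((\<lambda>x. logistic x * (1 - logistic x)) \<longlongrightarrow> 0) at_top"
    using tendsto_mult[OF logistic_at_bot tendsto_diff[OF tendsto_const[of 1] logistic_at_bot]]
      tendsto_mult[OF logistic_at_top tendsto_diff[OF tendsto_const[of 1] logistic_at_top]] by simp_all
  show "(P \<longlongrightarrow> 0) at_bot" "(P \<longlongrightarrow> 0) at_top"
    unfolding P_def[abs_def] tendsto_Zfun_iff
    using w by (auto intro!: bounded_bilinear.Zfun_prod_Bfun[OF bounded_bilinear_mult] Bf
    simp: tendsto_Zfun_iff)
qed

lemma G_lims: "(G \<longlongrightarrow> 0) at_bot" "(G \<longlongrightarrow> total_drop g) at_top"
proof -
  have "\<bar>left_avg g x\<bar> \<le> 1" "\<bar>right_avg g x\<bar> \<le> 1" for x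
    using bounds(9)[of x] right_avg_dev[OF near_bcont[OF g] bounds(1), of x] b by linarith+
  then have Bf: "Bfun (left_avg g) F" "Bfun (right_avg g) F" for F :: "real filter"
    by (auto intro!: BfunI[of _ 1])
  show "(G \<longlongrightarrow> 0) at_bot"
    unfolding G_def[abs_def] tendsto_Zfun_iff
    using logistic_at_bot by (auto intro!: bounded_bilinear.Zfun_prod_Bfun[OF bounded_bilinear_mult] Bf
    simp: tendsto_Zfun_iff)
  \<comment> \<open>The integral of \<open>g\<close> over \<open>(0, 1)\<close> split at
    \<open>z\<close>, hence constant; at \<open>x = 0\<close>, where \<open>logistic\<close> is
    \<open>1/2\<close>, it is \<open>total_drop g\<close>.\<close>
  have "((\<lambda>x. G x + (1 - logistic x) * right_avg g x) has_real_derivative 0) (at x)" for x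
    by (rule derivative_eq_intros G_deriv right_avg_deriv[OF near_bcont[OF g]] refl)+ algebra
  from DERIV_isconst_all[OF allI, OF this] have "G x + (1 - logistic x) * right_avg g x = G 0
      + (1 - logistic 0) * right_avg g 0" for x by blast
  moreover have "G 0 + (1 - logistic 0) * right_avg g 0 = total_drop g"
      by (simp add: G_def total_drop_def logistic_def)
  ultimately have "G x + (1 - logistic x) * right_avg g x = total_drop g" for x by metis
  then have "G = (\<lambda>x. total_drop g - (1 - logistic x) * right_avg g x)" by (auto
      simp: fun_eq_iff eq_diff_eq)
  moreover have "((\<lambda>x. 1 - logistic x) \<longlongrightarrow> 0) at_top"
    using tendsto_diff[OF tendsto_const[of 1] logistic_at_top] by simp
  then have "((\<lambda>x. (1 - logistic x) * right_avg g x) \<longlongrightarrow> 0) at_top"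
    by (auto intro!: bounded_bilinear.Zfun_prod_Bfun[OF bounded_bilinear_mult] Bf simp: tendsto_Zfun_iff)
  then have "((\<lambda>x. total_drop g - (1 - logistic x) * right_avg g x) \<longlongrightarrow>
      total_drop g - 0) at_top"
    by (intro tendsto_diff tendsto_const)
  ultimately show "(G \<longlongrightarrow> total_drop g) at_top" by simp
qed

lemma PB_lims:
  assumes "\<And>x. \<bar>f x\<bar> \<le> M"
  shows "((\<lambda>x. P x * f x) \<longlongrightarrow> 0) at_bot"
      "((\<lambda>x. P x * f x) \<longlongrightarrow> 0) at_top"
proof -
  have Bf: "Bfun f F" for F :: "real filter" using assms by (intro BfunI[of _ M]) auto
  show "((\<lambda>x. P x * f x) \<longlongrightarrow> 0) at_bot"
      "((\<lambda>x. P x * f x) \<longlongrightarrow> 0) at_top"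
    using P_lims by (auto intro!: bounded_bilinear.Zfun_prod_Bfun[OF bounded_bilinear_mult] Bf
    simp: tendsto_Zfun_iff)
qed

lemma gap_lims: "(gap \<longlongrightarrow> 0) at_bot" "(gap \<longlongrightarrow> 2 * total_drop g) at_top"
proof -
  have "gap = (\<lambda>x. 2 * G x - 2 * \<beta> * (P x * (k x - g x)))" by (auto simp: gap_def fun_eq_iff)
  then show "(gap \<longlongrightarrow> 0) at_bot" "(gap \<longlongrightarrow> 2 * total_drop g) at_top"
    using tendsto_diff[OF tendsto_mult[OF tendsto_const G_lims(1)] tendsto_mult[OF tendsto_const
    PB_lims(1)[OF bounds(12)]]]
     tendsto_diff[OF tendsto_mult[OF tendsto_const G_lims(2)] tendsto_mult[OF tendsto_const
     PB_lims(2)[OF bounds(12)]]]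
    by simp_all
qed

text \<open>At \<open>x = 0\<close> both moments are close to \<open>1/12\<close> and nearly cancel
  in the slope, while \<open>G 0\<close> is half of about \<open>1/3\<close>.\<close>

lemma kappa_dev: "\<bar>\<kappa> - 1/6\<bar> \<le> 3/2 * b" 
proof -
  have l: "logistic 0 = 1/2" by (simp add: logistic_def)
  show ?thesis
    using left_moment_dev[OF g, of 0] right_moment_dev[OF g, of 0] bounds(3)[of 0]
    unfolding \<kappa>_def slope_def G_def l abs_le_iff by (intro conjI) simp_all
qed

lemma terrace:
  assumes l: "0 < l" "l\<^sup>2 = 2 * b\<^sup>2"
  shows "\<exists>g1 g2. propagating_terrace l (-1, -1, 0, 0, 0) (1, 1, 0, 0, 0)
     [(-1, -1, 0, 0, 0), (total_drop g / (1 - total_drop g), - (total_drop g / (1 - total_drop g)), -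
     (total_drop g / (1 - total_drop g)), total_drop g / (1 - total_drop g), 0), (1, 1, 0, 0, 0)] 
     [g1, g2] [- (\<kappa> / (1 - total_drop g)), - (- (\<kappa> / (1 - total_drop g)))]"
proof -
  \<comment> \<open>The jump of \<open>c1\<close>. The limits at the right end are
    \<open>\<mu> - 1\<close> and \<open>\<mu> * (1 - 2 * total_drop g) - 1\<close>, and they are
    opposite exactly for this \<open>\<mu>\<close>.\<close>
  define \<mu> where "\<mu> = 1 / (1 - total_drop g)"
  have gam: "0 < 1 - total_drop g" "0 \<le> \<kappa>" using total_drop_dev[OF g] kappa_dev b by linarith+
  have mu: "0 < \<mu>" "\<mu> * (1 - total_drop g) = 1" using gam by (auto simp: \<mu>_def)
  have beta_mu: "\<beta> = b * \<mu>" by (simp add: layer_width_def \<mu>_def)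
  \<comment> \<open>Passage to the wave coordinate: \<open>z = logistic (\<Theta> x)\<close> has to
    satisfy \<open>z' = \<mu> * P\<close>, that is,
    \<open>\<Theta>' = \<mu> * speed g \<Theta>\<close>.\<close>
  have "continuous_on UNIV (\<lambda>x. \<mu> * speed g x)" "\<And>x. 0 < \<mu> * speed g x"
      "\<And>x. \<mu> * speed g x \<le> \<mu> * (1/5)"
    using bounds(10) mu speed_bounds(2)[OF g b(2)]
    by (auto intro!: continuous_intros cont(4) mult_left_mono)
  then obtain \<Theta> where \<Theta>:
      "\<And>x. (\<Theta> has_real_derivative \<mu> * speed g (\<Theta> x)) (at x)" and
    top: "filterlim \<Theta> at_top at_top" and bot: "filterlim \<Theta> at_bot at_bot"
    using autonomous_flow[of "\<lambda>x. \<mu> * speed g x" "\<mu> * (1/5)"] by blast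
  have ch: "((\<lambda>x. f (\<Theta> x)) has_real_derivative f' (\<Theta> x) * (\<mu> * speed g
      (\<Theta> x))) (at x)"
    if "\<And>x. (f has_real_derivative f' x) (at x)" for f f' x
    by (rule DERIV_chain2[where f = f and g = \<Theta>, OF that \<Theta>])
  let ?L = "\<lambda>x. logistic (\<Theta> x)" and ?d = "\<lambda>x. gap (\<Theta> x)" and ?P =
      "\<lambda>x. P (\<Theta> x)" and ?S = "\<lambda>x. slope g (\<Theta> x)"
    and ?G = "\<lambda>x. G (\<Theta> x)" and ?g = "\<lambda>x. g (\<Theta> x)" and ?k =
    "\<lambda>x. k (\<Theta> x)" and ?r = "\<lambda>x. r (\<Theta> x)"
  have logistic': "(logistic has_real_derivative logistic x * (1 - logistic x)) (at x)" for x
    using logistic_deriv[OF DERIV_ident, of x] by simp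
  have dL: "(?L has_real_derivative \<mu> * ?P x) (at x)" for x
    by (rule DERIV_cong[OF ch[of logistic "\<lambda>x. logistic x * (1 - logistic x)",
    OF logistic']]) (simp add: P_def)
  have dP: "(?P has_real_derivative \<mu> * ?P x * ?S x) (at x)" for x
    by (rule DERIV_cong[OF ch[of P "\<lambda>x. logistic x * (1 - logistic x) * slope g x",
    OF P_deriv]]) (simp add: P_def)
  have dG: "(?G has_real_derivative \<mu> * ?P x * ?g x) (at x)" for x
    by (rule DERIV_cong[OF ch[of G "\<lambda>x. logistic x * (1 - logistic x) * g x",
    OF G_deriv]]) (simp add: P_def)
  have dD: "(?d has_real_derivative \<mu> * ?P x * (1 - ?r x)) (at x)" for x
    by (rule DERIV_cong[OF ch[of gap "\<lambda>x. logistic x * (1 - logistic x) * (1 - r x)",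
    OF gap_deriv]]) (simp add: P_def)
  have dr: "(?r has_real_derivative \<mu> * (2 * ?G x * ?r x - ?g x * ?d x)) (at x)" for x
    by (rule DERIV_cong[OF ch[of r "\<lambda>x. (2 * G x * r x - g x * gap x) / speed g x",
    OF r_deriv]]) (use Q_nz[of "\<Theta> x"] in simp)
  have dg: "(?g has_real_derivative \<mu> * (?k x - (1 + \<beta> * ?S x) * ?g x) / \<beta>) (at x)" for x
    by (rule DERIV_cong[OF ch[of g "\<lambda>x. (k x - (1
    + \<beta> * slope g x) * g x) / (\<beta> * speed g x)", OF g_deriv]])
      (use Q_nz[of "\<Theta> x"] beta_nz in \<open>simp add: field_simps\<close>)
  define c1 where "c1 = (\<lambda>x. \<mu> * ?L x - 1)"
  define c2 where "c2 = (\<lambda>x. \<mu> * (?L x - ?d x) - 1)"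
  define u where "u = (\<lambda>x. - \<mu> * ?G x)"
  define q where "q = (\<lambda>x. - l\<^sup>2 * \<mu>\<^sup>2 * (?P x * ?g x))"
  define v where "v = - (\<mu> * \<kappa>)"
  have Ppos: "0 < P x" for x unfolding P_def
      using logistic_pos[of x] logistic_less_1[of x] bounds(10)[of x] by simp
  have qle: "q x \<le> 0" for x
  proof -
    have "0 \<le> l\<^sup>2 * \<mu>\<^sup>2 * (?P x * ?g x)"
      using Ppos[of "\<Theta> x"] bounds(4)[of "\<Theta> x"] by (intro mult_nonneg_nonneg) auto
    then show ?thesis by (simp add: q_def)
  qed
  \<comment> \<open>Since \<open>q \<le> 0\<close>, the exchange is always in its first branch and
    equals \<open>- u' * c1\<close>, so it cancels the term \<open>u' * c1\<close> of the first
    equation.\<close>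
  have ex: "exch l (c1 x) (c2 x) (q x) = - (q x / l\<^sup>2 * c1 x)" for x
  proof -
    have "0 \<le> - q x / l" using qle[of x] l(1) by (intro divide_nonneg_pos) simp_all
    then show ?thesis by (simp add: exch_def Let_def power2_eq_square)
  qed
  have ql: "q x / l\<^sup>2 = - \<mu>\<^sup>2 * (?P x * ?g x)" for x using l(1) by (simp add: q_def)
  have w: "wave_profile l c1 c2 u q v"
    unfolding wave_profile_def
  proof (intro exI allI conjI)
    fix x
    show "(c1 has_real_derivative \<mu>\<^sup>2 * ?P x) (at x)"
      unfolding c1_def by (rule derivative_eq_intros dL refl)+ (simp add: power2_eq_square)
    show "((\<lambda>x. \<mu>\<^sup>2 * ?P x) has_real_derivative \<mu>\<^sup>2 * (\<mu> * ?P x * ?S x))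
        (at x)"
      by (rule DERIV_cmult[OF dP])
    show "(c2 has_real_derivative \<mu>\<^sup>2 * (?P x * ?r x)) (at x)"
      unfolding c2_def by (rule derivative_eq_intros dL dD refl)+ (simp add: power2_eq_square algebra_simps)
    show "((\<lambda>x. \<mu>\<^sup>2 * (?P x * ?r x)) has_real_derivative
        \<mu>\<^sup>2 * (\<mu> * ?P x * ?S x * ?r x + \<mu> * (2 * ?G x * ?r x - ?g x * ?d x) * ?P x)) (at x)"
      by (rule DERIV_cmult[OF DERIV_mult[OF dP dr]])
    show "(u has_real_derivative q x / l\<^sup>2) (at x)"
      unfolding ql u_def by (rule DERIV_cong[OF DERIV_cmult[OF dG]]) (simp add: power2_eq_square)
    show "(q has_real_derivative 2 * u x + c1 x - c2 x) (at x)"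
    proof -
      have "(q has_real_derivative - l\<^sup>2 * \<mu>\<^sup>2 *
          (\<mu> * ?P x * ?S x * ?g x + \<mu> * (?k x - (1
          + \<beta> * ?S x) * ?g x) / \<beta> * ?P x)) (at x)"
        unfolding q_def by (rule DERIV_cmult[OF DERIV_mult[OF dP dg]])
      moreover have "\<mu> * ?P x * ?S x * ?g x + \<mu> * (?k x - (1
          + \<beta> * ?S x) * ?g x) / \<beta> * ?P x
         = \<mu> * ?P x * (?k x - ?g x) / \<beta>"
        using beta_nz by (simp add: field_simps)
      \<comment> \<open>Here \<open>b = l / sqrt 2\<close> enters: it makes the two linked
        first-order equations equivalent to \<open>l\<^sup>2 u'' = 2 u + c1 - c2\<close>.\<close>
      moreover have "l\<^sup>2 * \<mu>\<^sup>2 = 2 * \<beta> * \<beta>" unfolding l(2) beta_mu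
          by (simp add: power2_eq_square)
      moreover have "- (2 * \<beta> * \<beta>) * (\<mu> * ?P x * (?k x - ?g x) / \<beta>) = 2 * u x
          + c1 x - c2 x"
        using beta_nz by (simp add: u_def c1_def c2_def gap_def field_simps)
      ultimately show ?thesis by simp
    qed
    \<comment> \<open>Divided by the derivative of \<open>c1\<close> this is
      \<open>v = u - \<mu> * slope\<close>, which \<open>S_eq\<close> provides.\<close>
    show "- v * (\<mu>\<^sup>2 * ?P x) + (u x * (\<mu>\<^sup>2 * ?P x)
        + q x / l\<^sup>2 * c1 x) - \<mu>\<^sup>2 * (\<mu> * ?P x * ?S x)
        = - exch l (c1 x) (c2 x) (q x)"
      unfolding ex S_eq u_def v_def by (simp add: algebra_simps)
    have "c1 x - c2 x = \<mu> * ?d x" by (simp add: c1_def c2_def algebra_simps)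
    then have "q x / l\<^sup>2 * c2 x = q x / l\<^sup>2 * c1 x
        + \<mu>\<^sup>2 * (?P x * ?g x) * (\<mu> * ?d x)"
      unfolding ql by algebra
    then show "- v * (\<mu>\<^sup>2 * (?P x * ?r x)) - (u x * (\<mu>\<^sup>2 * (?P x * ?r x))
        + q x / l\<^sup>2 * c2 x) -
         \<mu>\<^sup>2 * (\<mu> * ?P x * ?S x * ?r x + \<mu> * (2 * ?G x * ?r x - ?g x * ?d x) * ?P x)
        = exch l (c1 x) (c2 x) (q x)"
      unfolding ex S_eq u_def v_def by (simp add: algebra_simps)
  qed
  have a: "\<mu> - 1 = total_drop g / (1 - total_drop g)" "\<mu> * total_drop g
      = total_drop g / (1 - total_drop g)" "\<mu> * (1 - 2 * total_drop g) - 1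
      = - (total_drop g / (1 - total_drop g))"
    using gam by (auto simp: \<mu>_def field_simps)
  note lt = filterlim_compose[OF _ top] and lb = filterlim_compose[OF _ bot]
  have cb: "(c1 \<longlongrightarrow> \<mu> * 0 - 1) at_bot"
      "(c2 \<longlongrightarrow> \<mu> * (0 - 0) - 1) at_bot"
      "(u \<longlongrightarrow> - \<mu> * 0) at_bot"
      "(q \<longlongrightarrow> - l\<^sup>2 * \<mu>\<^sup>2 * 0) at_bot"
    unfolding c1_def c2_def u_def q_def
    by (intro tendsto_intros lb[OF logistic_at_bot] lb[OF gap_lims(1)] lb[OF G_lims(1)] lb[OF
    PB_lims(1)[OF bounds(6)]])+
  have ct: "(c1 \<longlongrightarrow> \<mu> * 1 - 1) at_top"
      "(c2 \<longlongrightarrow> \<mu> * (1 - 2 * total_drop g) - 1) at_top"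
      "(u \<longlongrightarrow> - \<mu> * total_drop g) at_top"
      "(q \<longlongrightarrow> - l\<^sup>2 * \<mu>\<^sup>2 * 0) at_top"
    unfolding c1_def c2_def u_def q_def
    by (intro tendsto_intros lt[OF logistic_at_top] lt[OF gap_lims(2)] lt[OF G_lims(2)] lt[OF
    PB_lims(2)[OF bounds(6)]])+
  have v: "v = - (\<kappa> / (1 - total_drop g))" "v \<le> 0" using gam by (auto simp: v_def \<mu>_def)
  show ?thesis
    using terrace_of_profile[OF w v(2), of "total_drop g / (1 - total_drop g)"] cb ct a unfolding v(1) by simp
qed

end

section \<open>Existence for small \<open>l\<close> and the limits\<close>

lemma terrace_exists:
  assumes l: "0 < l" "l < 1/1000"
  shows "\<exists>a v. \<bar>a - 1/2\<bar> \<le> 10 * l \<and> \<bar>v + 1/4\<bar> \<le> 10 * l \<and>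
    (\<exists>g1 g2. propagating_terrace l (-1, -1, 0, 0, 0) (1, 1, 0, 0, 0)
       [(-1, -1, 0, 0, 0), (a, - a, - a, a, 0), (1, 1, 0, 0, 0)] [g1, g2] [v, - v])"
proof -
  define b where "b = l / sqrt 2"
  have "b \<le> l" using l by (simp add: b_def field_simps)
  moreover have "0 < b" using l by (simp add: b_def)
  ultimately have bl: "0 < b" "b \<le> 1/1000" "b \<le> l" using l by linarith+
  have b2: "l\<^sup>2 = 2 * b\<^sup>2" by (simp add: b_def power_divide)
  from fixed_point[OF bl(1,2)] obtain g k where "near b g" "near b k" "outer_map b g k = g"
      "inner_map b g k = k" by blast
  then interpret fixed_pair b g k using bl by unfold_locales
  have G: "\<bar>total_drop g - 1/3\<bar> \<le> b" by (rule total_drop_dev[OF g])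
  have h: "1/2 \<le> 1 - total_drop g" using G b by linarith
  have "total_drop g / (1 - total_drop g) - 1/2 = (3 * (total_drop g - 1/3) / 2) / (1 - total_drop g)"
    using h by (simp add: field_simps)
  then have "\<bar>total_drop g / (1 - total_drop g) - 1/2\<bar>
      = \<bar>3 * (total_drop g - 1/3) / 2\<bar> / (1 - total_drop g)" using h by (simp only: abs_divide)
  also have "\<dots> \<le> (3 / 2 * b) / (1/2)" using h G b by (intro frac_le) auto
  also have "\<dots> \<le> 10 * l" using bl by simp
  finally have 1: "\<bar>total_drop g / (1 - total_drop g) - 1/2\<bar> \<le> 10 * l" .
  \<comment> \<open>The numerator is centred at the limits \<open>1/6\<close> of
    \<open>\<kappa>\<close> and \<open>1/3\<close> of \<open>total_drop g\<close>, where the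
    quotient is \<open>(1/6) / (2/3) = 1/4\<close>.\<close>
  have "- (\<kappa> / (1 - total_drop g)) + 1/4
      = (- (\<kappa> - 1/6) - (total_drop g - 1/3) / 4) / (1 - total_drop g)"
    using h by (simp add: field_simps)
  then have "\<bar>- (\<kappa> / (1 - total_drop g)) + 1/4\<bar>
      = \<bar>- (\<kappa> - 1/6) - (total_drop g - 1/3) / 4\<bar> / (1 - total_drop g)" using h
      by (simp only: abs_divide)
  also have "\<dots> \<le> (2 * b) / (1/2)"
  proof (intro frac_le h)
    show "\<bar>- (\<kappa> - 1/6) - (total_drop g - 1/3) / 4\<bar> \<le> 2 * b"
      using kappa_dev G b(1) unfolding abs_le_iff diff_divide_distrib by (intro conjI) linarith+
  qed (use b(1) in simp_all)
  also have "\<dots> \<le> 10 * l" using bl by simp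
  finally have 2: "\<bar>- (\<kappa> / (1 - total_drop g)) + 1/4\<bar> \<le> 10 * l" .
  show ?thesis using 1 2 terrace[OF l(1) b2] by blast
qed

theorem theorem1:
  shows "\<exists>l0>0. \<exists>c1s c2s u1s u2s v1 v2 :: real \<Rightarrow> real.
    (\<forall>l. 0 < l \<and> l < l0 \<longrightarrow>
       (\<exists>g1 g2. propagating_terrace l (-1, -1, 0, 0, 0) (1, 1, 0, 0, 0)
          [(-1, -1, 0, 0, 0), (c1s l, c2s l, u1s l, u2s l, 0), (1, 1, 0, 0, 0)]
          [g1, g2] [v1 l, v2 l]))
    \<and> (c1s \<longlongrightarrow> 1/2) (at_right 0) \<and> (c2s \<longlongrightarrow> -1/2) (at_right 0)
    \<and> (v2 \<longlongrightarrow> 1/4) (at_right 0) \<and> (v1 \<longlongrightarrow> -1/4) (at_right 0)"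
proof -
  \<comment> \<open>With the range of \<open>l\<close> as a premise inside the quantifiers, choice
    yields total functions \<open>a\<close> and \<open>v\<close>; their values at other
    \<open>l\<close> are arbitrary and do not affect limits at \<open>0\<close> from the
    right.\<close>
  have "\<forall>l. \<exists>a v. 0 < l \<and> l < 1/1000 \<longrightarrow> \<bar>a - 1/2\<bar>
      \<le> 10 * l \<and> \<bar>v + 1/4\<bar> \<le> 10 * l \<and>
    (\<exists>g1 g2. propagating_terrace l (-1, -1, 0, 0, 0) (1, 1, 0, 0, 0)
       [(-1, -1, 0, 0, 0), (a, - a, - a, a, 0), (1, 1, 0, 0, 0)] [g1, g2] [v, - v])"
    using terrace_exists by blast
  then obtain a v where av:
      "\<And>l. 0 < l \<Longrightarrow> l < 1/1000 \<Longrightarrow> \<bar>a l - 1/2\<bar> \<le> 10 * l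
      \<and> \<bar>v l + 1/4\<bar> \<le> 10 * l \<and>
    (\<exists>g1 g2. propagating_terrace l (-1, -1, 0, 0, 0) (1, 1, 0, 0, 0)
       [(-1, -1, 0, 0, 0), (a l, - a l, - a l, a l, 0), (1, 1, 0, 0, 0)] [g1, g2] [v l, - v l])"
    by metis
  have ev: "eventually (\<lambda>l::real. 0 < l \<and> l < 1/1000) (at_right 0)"
    by (auto simp: eventually_at_right_field intro!: exI[of _ "1/1000"])
  have lim0: "((\<lambda>l::real. 10 * l) \<longlongrightarrow> 0) (at_right 0)" by real_asymp
  have lim: "(f \<longlongrightarrow> m) (at_right 0)" if
      "\<And>l. 0 < l \<Longrightarrow> l < 1/1000 \<Longrightarrow> \<bar>f l - m\<bar> \<le> 10 * l"
    for f :: "real \<Rightarrow> real" and m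
  proof -
    have "((\<lambda>l. f l - m) \<longlongrightarrow> 0) (at_right 0)"
      by (rule Lim_null_comparison[OF _ lim0]) (use ev that in \<open>auto elim!: eventually_mono\<close>)
    then show ?thesis by (simp add: LIM_zero_iff)
  qed
  have a: "(a \<longlongrightarrow> 1/2) (at_right 0)" and v: "(v \<longlongrightarrow> -1/4) (at_right 0)"
    using av by (auto intro!: lim)
  show ?thesis
    by (rule exI[of _ "1/1000"], rule conjI, simp,
        rule exI[of _ a], rule exI[of _ "\<lambda>l. - a l"], rule exI[of _
        "\<lambda>l. - a l"], rule exI[of _ a],
        rule exI[of _ v], rule exI[of _ "\<lambda>l. - v l"])
      (use av a v tendsto_minus[OF a] tendsto_minus[OF v] in auto)
qed

end
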